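(* Let $K$ be a partition of $X$ parametrized by $(T,\mathcal A,\phi)$, let $d\in\mathcal D_A(X,\mathcal O)$, let $\mu\in\mathcal M_P(X,\mathcal O)$ and let $\alpha>0$. Assume that $K$ is minimal and that $g_d$ is super-exponential and thick. Then the following are equivalent: (i) $(g_d)^\alpha$ and $g_\mu$ are bi-Lipschitz equivalent (there are $c_1,c_2>0$ with $c_1g_d(w)^\alpha\le g_\mu(w)\le c_2g_d(w)^\alpha$ for all $w\in T$) and $g_d$ is uniformly finite; (ii) $\mu$ is $\alpha$-Ahlfors regular with respect to $d$. Moreover, if either of these two conditions is satisfied, then $g_\mu$ and $g_d$ are exponential.
   Context: Setting. $T$ is a countably infinite set, $\mathcal A:T\times T\to\{0,1\}$ is symmetric and vanishes on the diagonal, the graph on $T$ with edges $\{(w,v):\mathcal A(w,v)=1\}$ is a locally finite tree, and $\phi\in T$ is a fixed root. For $w\in T$: $|w|$ is the tree distance from $\phi$ to $w$; $(T)_m=\{w:|w|=m\}$; $\pi(w)$ is the neighbour of $w$ on the geodesic from $\phi$ to $w$ ($\pi(\phi)=\phi$); $S(w)$ is the set of neighbours of $w$ other than $\pi(w)$; $T_w$ is the set of $v\in T$ such that $w$ lies on the geodesic from $\phi$ to $v$. $\Sigma$ is the set of infinite geodesic rays $\omega=([\omega]_0=\phi,[\omega]_1,\ldots)$ of the tree starting at $\phi$. $(X,\mathcal O)$ is a compact metrizable topological space with no isolated point. A partition $K$ of $X$ parametrized by $(T,\mathcal A,\phi)$ assigns to each $w\in T$ a nonempty compact set $K_w\subseteq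 X$ such that $K_\phi=X$, $K_w=\bigcup_{v\in S(w)}K_v$ for all $w$, and $\bigcap_{m\ge0}K_{[\omega]_m}$ is a single point for every $\omega\in\Sigma$. $K$ is minimal if $K_w\setminus\bigcup_{v\in(T)_{|w|},v\ne w}K_v\neq\emptyset$ for every $w\in T$. Weight functions. A weight function is $g:T\to(0,1]$ with $g(\phi)=1$, $g(\pi(w))\ge g(w)$ for all $w$, and $\lim_{m\to\infty}\sup_{w\in(T)_m}g(w)=0$. For $s\in(0,1)$, $\Lambda^g_s=\{w\in T: g(\pi(w))>s\ge g(w)\}$; for $s\ge1$, $\Lambda^g_s=\{\phi\}$. For an integer $M\ge0$, $x\in X$, $s>0$, $U^g_M(x,s)$ is the set of $y\in X$ for which there are $w(1),\ldots,w(M+1)\in\Lambda^g_s$ with $x\in K_{w(1)}$, $y\in K_{w(M+1)}$ and $K_{w(i)}\cap K_{w(i+1)}\ne\emptyset$ for $1\le i\le M$. A function $f:T\to(0,\infty)$ is sub-exponential if there are $m\ge0$, $c_1\in(0,1)$ with $f(v)\le c_1f(w)$ whenever $v\in T_w$, $|v|\ge|w|+m$; super-exponential if there is $c_2\in(0,1)$ with $f(v)\ge c_2f(w)$ whenever $v\in S(w)$; exponential if both. A weight function $g$ is uniformly finite if $\sup\{\#\{v\in\Lambda^g_s:K_v\cap K_w\ne\emptyset\}: s\in(0,1],w\in\Lambda^g_s\}<\infty$; it is thick if there are $M\ge1$ and $\alpha>0$ such that for all $s\in(0,1]$ and $w\in\Lambda^g_s$, $K_w\supseteq U^g_M(x,\alpha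 s)$ for some $x\in K_w$. Metrics and measures. $\mathcal D(X,\mathcal O)$ is the set of metrics $d$ on $X$ inducing $\mathcal O$ with $\operatorname{diam}(X,d)=1$; $B_d(x,r)=\{y:d(x,y)<r\}$; $g_d(w)=\operatorname{diam}(K_w,d)$. $d$ is $M$-adapted to $g$ if there are $\alpha_1,\alpha_2>0$ with $U^g_M(x,\alpha_1r)\subseteq B_d(x,r)\subseteq U^g_M(x,\alpha_2r)$ for all $x\in X$, $r>0$. $\mathcal D_A(X,\mathcal O)$ is the set of $d\in\mathcal D(X,\mathcal O)$ that are $M$-adapted to $g_d$ for some $M\ge0$. $\mathcal M_P(X,\mathcal O)$ is the set of Radon probability measures $\mu$ on $X$ with $\mu(\{x\})=0$ for all $x$ and $\mu(K_w)>0$ for all $w\in T$; $g_\mu(w)=\mu(K_w)$. $\mu$ is $\alpha$-Ahlfors regular with respect to $d$ if there are $C_1,C_2>0$ with $C_1r^\alpha\le\mu(B_d(x,r))\le C_2r^\alpha$ for all $x\in X$ and $r\in[0,\operatorname{diam}(X,d)]$.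
   Formalization: The "Moreover" clause is false if vertices with #S(w)=1 can form arbitrarily long chains; exponentiality of g_μ and g_d is proved when some N bounds the distance from every w to a descendant v with #S(v)≥2 (a necessary condition); super-exponentiality is proved without it. *)

theory Defs
  imports "HOL-Analysis.Analysis" "HOL-Probability.Probability_Measure"
begin

section \<open>Rooted locally finite trees\<close>

definition simple_path :: "'a set \<Rightarrow> ('a \<Rightarrow> 'a \<Rightarrow> nat) \<Rightarrow> 'a \<Rightarrow> 'a \<Rightarrow> 'a list \<Rightarrow> bool" where
  "simple_path T A w v p \<longleftrightarrow>
     p \<noteq> [] \<and> hd p = w \<and> last p = v \<and> set p \<subseteq> T \<and> distinct p \<and>
     (\<forall>i. Suc i < length p \<longrightarrow> A (p ! i) (p ! Suc i) = 1)"

definition rooted_tree :: "'a set \<Rightarrow> ('a \<Rightarrow> 'a \<Rightarrow> nat) \<Rightarrow> 'a \<Rightarrow> bool" where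
  "rooted_tree T A \<phi> \<longleftrightarrow>
     countable T \<and> infinite T \<and> \<phi> \<in> T \<and>
     (\<forall>w\<in>T. \<forall>v\<in>T. A w v \<in> {0, 1} \<and> A w v = A v w) \<and>
     (\<forall>w\<in>T. A w w = 0) \<and>
     (\<forall>w\<in>T. finite {v\<in>T. A w v = 1}) \<and>
     (\<forall>w\<in>T. \<forall>v\<in>T. \<exists>!p. simple_path T A w v p)"

definition geodesic :: "'a set \<Rightarrow> ('a \<Rightarrow> 'a \<Rightarrow> nat) \<Rightarrow> 'a \<Rightarrow> 'a \<Rightarrow> 'a list" where
  "geodesic T A w v = (THE p. simple_path T A w v p)"

definition height :: "'a set \<Rightarrow> ('a \<Rightarrow> 'a \<Rightarrow> nat) \<Rightarrow> 'a \<Rightarrow> 'a \<Rightarrow> nat" where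
  "height T A \<phi> w = length (geodesic T A \<phi> w) - 1"

definition level :: "'a set \<Rightarrow> ('a \<Rightarrow> 'a \<Rightarrow> nat) \<Rightarrow> 'a \<Rightarrow> nat \<Rightarrow> 'a set" where
  "level T A \<phi> m = {w\<in>T. height T A \<phi> w = m}"

definition parent :: "'a set \<Rightarrow> ('a \<Rightarrow> 'a \<Rightarrow> nat) \<Rightarrow> 'a \<Rightarrow> 'a \<Rightarrow> 'a" where
  "parent T A \<phi> w = (if w = \<phi> then \<phi> else last (butlast (geodesic T A \<phi> w)))"

definition children :: "'a set \<Rightarrow> ('a \<Rightarrow> 'a \<Rightarrow> nat) \<Rightarrow> 'a \<Rightarrow> 'a \<Rightarrow> 'a set" where
  "children T A \<phi> w = {v\<in>T. A w v = 1} - {parent T A \<phi> w}"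

definition subtree :: "'a set \<Rightarrow> ('a \<Rightarrow> 'a \<Rightarrow> nat) \<Rightarrow> 'a \<Rightarrow> 'a \<Rightarrow> 'a set" where
  "subtree T A \<phi> w = {v\<in>T. w \<in> set (geodesic T A \<phi> v)}"

text \<open>
  There is a bound on the lengths of chains of vertices with one child each; this holds, for
  instance, if every vertex has at least two children. It is exactly what sub-exponentiality of
  \<open>g\<^sub>d\<close> and \<open>g\<^sub>\<mu>\<close> requires of the tree: a vertex with a single child has the same cell as that
  child. For the Cantor set with its usual metric and measure, indexing cylinders of depth \<open>n\<close> by
  chains of \<open>n + 1\<close> successive vertices yields a minimal partition with \<open>g\<^sub>d\<close> super-exponential,
  thick and uniformly finite and the measure 1-Ahlfors regular, but \<open>g\<^sub>d = g\<^sub>\<mu>\<close> is constant along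
  arbitrarily long chains.
\<close>

definition uniformly_branching :: "'a set \<Rightarrow> ('a \<Rightarrow> 'a \<Rightarrow> nat) \<Rightarrow> 'a \<Rightarrow> bool" where
  "uniformly_branching T A \<phi> \<longleftrightarrow>
     (\<exists>N::nat. \<forall>w\<in>T. \<exists>v\<in>subtree T A \<phi> w.
        height T A \<phi> v \<le> height T A \<phi> w + N \<and> card (children T A \<phi> v) \<ge> 2)"

definition rays :: "'a set \<Rightarrow> ('a \<Rightarrow> 'a \<Rightarrow> nat) \<Rightarrow> 'a \<Rightarrow> (nat \<Rightarrow> 'a) set" where
  "rays T A \<phi> = {\<omega>. \<forall>m. simple_path T A \<phi> (\<omega> m) (map \<omega> [0..<Suc m])}"


section \<open>Partitions\<close>

definition partition_param ::
    "'x topology \<Rightarrow> 'a set \<Rightarrow> ('a \<Rightarrow> 'a \<Rightarrow> nat) \<Rightarrow> 'a \<Rightarrow> ('a \<Rightarrow> 'x set) \<Rightarrow> bool" where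
  "partition_param X T A \<phi> K \<longleftrightarrow>
     (\<forall>w\<in>T. K w \<noteq> {} \<and> compactin X (K w)) \<and>
     K \<phi> = topspace X \<and>
     (\<forall>w\<in>T. K w = (\<Union>v\<in>children T A \<phi> w. K v)) \<and>
     (\<forall>\<omega>\<in>rays T A \<phi>. \<exists>x. (\<Inter>m. K (\<omega> m)) = {x})"

definition minimal_partition ::
    "'a set \<Rightarrow> ('a \<Rightarrow> 'a \<Rightarrow> nat) \<Rightarrow> 'a \<Rightarrow> ('a \<Rightarrow> 'x set) \<Rightarrow> bool" where
  "minimal_partition T A \<phi> K \<longleftrightarrow>
     (\<forall>w\<in>T. K w - (\<Union>v\<in>level T A \<phi> (height T A \<phi> w) - {w}. K v) \<noteq> {})"


section \<open>Scales, neighbourhoods and properties of weights\<close>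

text \<open>
  The notions involving \<open>scale\<close> below are meant for weight functions \<open>g\<close>: positive, at most 1,
  equal to 1 at the root, nonincreasing along the tree and uniformly tending to 0 along its levels.
  They are stated for arbitrary \<open>g\<close>, so that none of this is smuggled in as a hypothesis. For a
  minimal partition of a space without isolated points, the diameter function of an admissible
  metric always has these properties.
\<close>

definition scale ::
    "'a set \<Rightarrow> ('a \<Rightarrow> 'a \<Rightarrow> nat) \<Rightarrow> 'a \<Rightarrow> ('a \<Rightarrow> real) \<Rightarrow> real \<Rightarrow> 'a set" where
  "scale T A \<phi> g s =
     (if s \<ge> 1 then {\<phi>} else {w\<in>T. g (parent T A \<phi> w) > s \<and> s \<ge> g w})"

definition nbhd ::
    "'a set \<Rightarrow> ('a \<Rightarrow> 'a \<Rightarrow> nat) \<Rightarrow> 'a \<Rightarrow> ('a \<Rightarrow> 'x set) \<Rightarrow> ('a \<Rightarrow> real) \<Rightarrow> nat \<Rightarrow> 'x \<Rightarrow> real \<Rightarrow> 'x set"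
  where
  "nbhd T A \<phi> K g M x s =
     {y. \<exists>w :: nat \<Rightarrow> 'a.
           (\<forall>i\<in>{1..M+1}. w i \<in> scale T A \<phi> g s) \<and> x \<in> K (w 1) \<and> y \<in> K (w (M+1)) \<and>
           (\<forall>i\<in>{1..M}. K (w i) \<inter> K (w (i+1)) \<noteq> {})}"

definition sub_exponential ::
    "'a set \<Rightarrow> ('a \<Rightarrow> 'a \<Rightarrow> nat) \<Rightarrow> 'a \<Rightarrow> ('a \<Rightarrow> real) \<Rightarrow> bool" where
  "sub_exponential T A \<phi> f \<longleftrightarrow>
     (\<forall>w\<in>T. 0 < f w) \<and>
     (\<exists>m::nat. \<exists>c\<^sub>1\<in>{0<..<1}. \<forall>w\<in>T. \<forall>v\<in>subtree T A \<phi> w.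
        height T A \<phi> v \<ge> height T A \<phi> w + m \<longrightarrow> f v \<le> c\<^sub>1 * f w)"

definition super_exponential ::
    "'a set \<Rightarrow> ('a \<Rightarrow> 'a \<Rightarrow> nat) \<Rightarrow> 'a \<Rightarrow> ('a \<Rightarrow> real) \<Rightarrow> bool" where
  "super_exponential T A \<phi> f \<longleftrightarrow>
     (\<forall>w\<in>T. 0 < f w) \<and>
     (\<exists>c\<^sub>2\<in>{0<..<1}. \<forall>w\<in>T. \<forall>v\<in>children T A \<phi> w. f v \<ge> c\<^sub>2 * f w)"

definition exponential ::
    "'a set \<Rightarrow> ('a \<Rightarrow> 'a \<Rightarrow> nat) \<Rightarrow> 'a \<Rightarrow> ('a \<Rightarrow> real) \<Rightarrow> bool" where
  "exponential T A \<phi> f \<longleftrightarrow> sub_exponential T A \<phi> f \<and> super_exponential T A \<phi> f"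

definition uniformly_finite ::
    "'a set \<Rightarrow> ('a \<Rightarrow> 'a \<Rightarrow> nat) \<Rightarrow> 'a \<Rightarrow> ('a \<Rightarrow> 'x set) \<Rightarrow> ('a \<Rightarrow> real) \<Rightarrow> bool" where
  "uniformly_finite T A \<phi> K g \<longleftrightarrow>
     (\<exists>N::nat. \<forall>s\<in>{0<..1}. \<forall>w\<in>scale T A \<phi> g s.
        finite {v\<in>scale T A \<phi> g s. K v \<inter> K w \<noteq> {}} \<and>
        card {v\<in>scale T A \<phi> g s. K v \<inter> K w \<noteq> {}} \<le> N)"

definition thick ::
    "'a set \<Rightarrow> ('a \<Rightarrow> 'a \<Rightarrow> nat) \<Rightarrow> 'a \<Rightarrow> ('a \<Rightarrow> 'x set) \<Rightarrow> ('a \<Rightarrow> real) \<Rightarrow> bool" where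
  "thick T A \<phi> K g \<longleftrightarrow>
     (\<exists>M\<ge>1. \<exists>\<alpha>>0. \<forall>s\<in>{0<..1}. \<forall>w\<in>scale T A \<phi> g s.
        \<exists>x\<in>K w. nbhd T A \<phi> K g M x (\<alpha> * s) \<subseteq> K w)"

definition bi_Lipschitz_equivalent :: "'a set \<Rightarrow> ('a \<Rightarrow> real) \<Rightarrow> ('a \<Rightarrow> real) \<Rightarrow> bool" where
  "bi_Lipschitz_equivalent T f g \<longleftrightarrow>
     (\<exists>c\<^sub>1>0. \<exists>c\<^sub>2>0. \<forall>w\<in>T. c\<^sub>1 * f w \<le> g w \<and> g w \<le> c\<^sub>2 * f w)"


section \<open>Metrics and measures\<close>

definition mdiam :: "'x metric \<Rightarrow> 'x set \<Rightarrow> real" where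
  "mdiam d S = (SUP (x, y)\<in>S \<times> S. mdist d x y)"

definition metrics_on :: "'x topology \<Rightarrow> 'x metric set" where
  "metrics_on X = {d. mtopology_of d = X \<and> mdiam d (topspace X) = 1}"

definition adapted_to ::
    "'a set \<Rightarrow> ('a \<Rightarrow> 'a \<Rightarrow> nat) \<Rightarrow> 'a \<Rightarrow> ('a \<Rightarrow> 'x set) \<Rightarrow> nat \<Rightarrow> 'x metric \<Rightarrow> ('a \<Rightarrow> real) \<Rightarrow> bool"
  where
  "adapted_to T A \<phi> K M d g \<longleftrightarrow>
     (\<exists>\<alpha>\<^sub>1>0. \<exists>\<alpha>\<^sub>2>0. \<forall>x\<in>mspace d. \<forall>r>0.
        nbhd T A \<phi> K g M x (\<alpha>\<^sub>1 * r) \<subseteq> mball_of d x r \<and>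
        mball_of d x r \<subseteq> nbhd T A \<phi> K g M x (\<alpha>\<^sub>2 * r))"

definition adapted_metrics ::
    "'x topology \<Rightarrow> 'a set \<Rightarrow> ('a \<Rightarrow> 'a \<Rightarrow> nat) \<Rightarrow> 'a \<Rightarrow> ('a \<Rightarrow> 'x set) \<Rightarrow> 'x metric set" where
  "adapted_metrics X T A \<phi> K =
     {d\<in>metrics_on X. \<exists>M. adapted_to T A \<phi> K M d (\<lambda>w. mdiam d (K w))}"

definition radon_prob :: "'x topology \<Rightarrow> 'x measure \<Rightarrow> bool" where
  "radon_prob X \<mu> \<longleftrightarrow>
     prob_space \<mu> \<and> space \<mu> = topspace X \<and>
     sets \<mu> = sigma_sets (topspace X) {U. openin X U} \<and>
     (\<forall>B\<in>sets \<mu>. emeasure \<mu> B = (SUP C\<in>{C. compactin X C \<and> C \<subseteq> B}. emeasure \<mu> C))"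

definition partition_measures ::
    "'x topology \<Rightarrow> 'a set \<Rightarrow> ('a \<Rightarrow> 'x set) \<Rightarrow> 'x measure set" where
  "partition_measures X T K =
     {\<mu>. radon_prob X \<mu> \<and> (\<forall>x\<in>topspace X. measure \<mu> {x} = 0) \<and> (\<forall>w\<in>T. measure \<mu> (K w) > 0)}"

definition Ahlfors_regular :: "real \<Rightarrow> 'x metric \<Rightarrow> 'x measure \<Rightarrow> bool" where
  "Ahlfors_regular \<alpha> d \<mu> \<longleftrightarrow>
     (\<exists>C\<^sub>1>0. \<exists>C\<^sub>2>0. \<forall>x\<in>mspace d. \<forall>r\<in>{0..mdiam d (mspace d)}.
        C\<^sub>1 * r powr \<alpha> \<le> measure \<mu> (mball_of d x r) \<and>
        measure \<mu> (mball_of d x r) \<le> C\<^sub>2 * r powr \<alpha>)"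

end

(*
The weight g of a cell is its diameter, and adaptedness makes balls of radius r comparable to unions
of chains of cells of scale r. If mu(K_w) is comparable to g(w)^alpha, a ball contains such a cell,
and by uniform finiteness it is covered by boundedly many of them, so mu is Ahlfors regular.
Conversely, thickness puts a ball of radius comparable to g(w) inside K_w, which gives the lower
bound on mu(K_w). Minimality makes the cells at the thick centres of the cells of scale s pairwise
disjoint. Those touching a given cell lie in one ball of radius 3s and each carries mass comparable
to s^alpha, hence there are boundedly many.
At a branching vertex p, a thick core of one child is disjoint from every other child and carries a
definite fraction of mu(K_p), so mu(K) drops by a fixed factor at each branching vertex on a path;
comparability transfers this decay to the diameters.
*)
theory Submission
  imports Defs
begin

section \<open>Rooted trees\<close>

text \<open>Three mismatches shape the proof. Adaptedness comes with one chain length, thickness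
  with another; \<open>thick_chain\<close> makes thickness available for every length, at the cost
  of a smaller constant. Minimality compares cells of equal height, whereas a cut
  \<open>scale\<close> mixes heights; \<open>cut_sub\<close> carries it over to cuts. Finally, a
  vertex other than the root whose parent has the same weight lies in no cut, so lower bounds for a
  cell start from a cut at half its weight, which has a member below the given vertex. The weight
  stays abstract until the last section, where rays and compactness show that diameters
  qualify.\<close>

locale rooted_tree_loc =
  fixes T :: "'a set" and A :: "'a \<Rightarrow> 'a \<Rightarrow> nat" and \<phi> :: 'a
  assumes rooted_tree: "rooted_tree T A \<phi>"
begin

abbreviation "geo \<equiv> geodesic T A \<phi>"
abbreviation "par \<equiv> parent T A \<phi>"
abbreviation "ht \<equiv> height T A \<phi>"
abbreviation "chd \<equiv> children T A \<phi>"
abbreviation "sub \<equiv> subtree T A \<phi>"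

section \<open>Geodesics, parents and children\<close>

lemma root_in [simp]: "\<phi> \<in> T"
  using rooted_tree by (simp add: rooted_tree_def)

lemma edge_sym: "w \<in> T \<Longrightarrow> v \<in> T \<Longrightarrow> A w v = A v w"
  using rooted_tree by (simp add: rooted_tree_def)

lemma edge_irrefl: "w \<in> T \<Longrightarrow> A w w = 0"
  using rooted_tree by (simp add: rooted_tree_def)

lemma finite_children: "w \<in> T \<Longrightarrow> finite (chd w)"
  using rooted_tree by (simp add: rooted_tree_def children_def)

lemma simple_path_ex1: "w \<in> T \<Longrightarrow> v \<in> T \<Longrightarrow> \<exists>!p. simple_path T A w v p"
  using rooted_tree by (simp add: rooted_tree_def)

lemma simple_path_geo: "v \<in> T \<Longrightarrow> simple_path T A \<phi> v (geo v)"
  unfolding geodesic_def by (rule theI') (simp add: simple_path_ex1)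

lemma geo_eqI: "v \<in> T \<Longrightarrow> simple_path T A \<phi> v p \<Longrightarrow> geo v = p"
  using simple_path_ex1[of \<phi> v] simple_path_geo by auto

lemma geo_root: "geo \<phi> = [\<phi>]"
  by (rule geo_eqI) (auto simp: simple_path_def)

lemma simple_path_snoc:
  assumes "simple_path T A w v p" "u \<in> T" "u \<notin> set p" "A v u = 1"
  shows "simple_path T A w u (p @ [u])"
  unfolding simple_path_def
proof (intro conjI allI impI)
  show "A ((p @ [u]) ! i) ((p @ [u]) ! Suc i) = 1" if i: "Suc i < length (p @ [u])" for i
  proof (cases "Suc i < length p")
    case True
    then show ?thesis using assms(1) by (simp add: simple_path_def nth_append)
  next
    case False
    then have "i = length p - 1" "p \<noteq> []" using i assms(1) by (auto simp: simple_path_def)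
    then have "(p @ [u]) ! i = v" "(p @ [u]) ! Suc i = u"
      using assms(1) by (auto simp: simple_path_def nth_append last_conv_nth)
    then show ?thesis using assms(4) by simp
  qed
qed (use assms in \<open>auto simp: simple_path_def\<close>)

text \<open>A prefix of a simple path is simple, so by uniqueness deleting the last vertex of a
  geodesic leaves the geodesic to the parent.\<close>

lemma geo_par:
  assumes "v \<in> T" "v \<noteq> \<phi>"
  shows "par v \<in> T" "A (par v) v = 1" "geo v = geo (par v) @ [v]"
proof -
  define q where "q = butlast (geo v)"
  note sp = simple_path_geo[OF assms(1)]
  have split: "geo v = q @ [v]"
    using sp unfolding q_def simple_path_def by (metis append_butlast_last_id)
  have "q \<noteq> []"
    using sp assms(2) split by (auto simp: simple_path_def)
  have par: "par v = last q"
    by (simp add: parent_def assms(2) q_def)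
  show T: "par v \<in> T"
    using sp \<open>q \<noteq> []\<close> unfolding par split simple_path_def by auto
  have nth: "A ((q @ [v]) ! i) ((q @ [v]) ! Suc i) = 1" if "i < length q" for i
    using sp that unfolding split simple_path_def by auto
  show "A (par v) v = 1"
    using nth[of "length q - 1"] \<open>q \<noteq> []\<close> unfolding par by (simp add: nth_append last_conv_nth)
  have "simple_path T A \<phi> (last q) q"
    unfolding simple_path_def
  proof (intro conjI allI impI)
    show "A (q ! i) (q ! Suc i) = 1" if "Suc i < length q" for i
      using nth[of i] that by (simp add: nth_append)
  qed (use sp \<open>q \<noteq> []\<close> in \<open>auto simp: split simple_path_def\<close>)
  then show "geo v = geo (par v) @ [v]"
    using geo_eqI[OF T] par split by simp
qed

lemma par_root [simp]: "par \<phi> = \<phi>"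
  by (simp add: parent_def)

lemma par_in: "v \<in> T \<Longrightarrow> par v \<in> T"
  by (cases "v = \<phi>") (auto simp: geo_par)

lemma ht_root [simp]: "ht \<phi> = 0"
  by (simp add: height_def geo_root)

lemma ht_par: "v \<in> T \<Longrightarrow> v \<noteq> \<phi> \<Longrightarrow> ht v = Suc (ht (par v))"
  using geo_par(3)[of v] simple_path_geo[OF par_in[of v]]
  by (simp add: height_def simple_path_def)

lemma ht_eq_0_iff: "v \<in> T \<Longrightarrow> ht v = 0 \<longleftrightarrow> v = \<phi>"
  using ht_par by force

text \<open>If \<open>v\<close> lay on the geodesic to \<open>w\<close>, the tail from
  \<open>v\<close> and the edge from \<open>v\<close> to \<open>w\<close> would be two simple paths.
  So \<open>v\<close> is off the geodesic and extends it.\<close>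

lemma par_eqI:
  assumes w: "w \<in> T" and v: "v \<in> T" and e: "A w v = 1" and ne: "v \<noteq> par w"
  shows "v \<noteq> \<phi>" "par v = w"
proof -
  note sp = simple_path_geo[OF w]
  have "v \<noteq> w" using e edge_irrefl[OF w] by auto
  have nin: "v \<notin> set (geo w)"
  proof
    assume "v \<in> set (geo w)"
    then obtain i where i: "i < length (geo w)" "geo w ! i = v" by (auto simp: in_set_conv_nth)
    have "w \<noteq> \<phi>" using \<open>v \<in> set (geo w)\<close> \<open>v \<noteq> w\<close> geo_root by auto
    have par: "par w = last (butlast (geo w))" by (simp add: parent_def \<open>w \<noteq> \<phi>\<close>)
    have last: "geo w ! (length (geo w) - 1) = w"
      using sp by (metis last_conv_nth simple_path_def)
    \<comment> \<open>The last two positions carry \<open>w\<close> and its parent, so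
      \<open>v\<close> would occur earlier and the tail from it would be longer than an
      edge.\<close>
    have "i \<noteq> length (geo w) - 1" using last i \<open>v \<noteq> w\<close> by auto
    moreover have "i \<noteq> length (geo w) - 2"
    proof
      assume "i = length (geo w) - 2"
      moreover have "last (butlast (geo w)) = geo w ! (length (geo w) - 2)"
        using i \<open>i \<noteq> length (geo w) - 1\<close>
        by (subst last_conv_nth) (auto simp: nth_butlast numeral_2_eq_2 simp flip: length_0_conv)
      ultimately show False using ne i par by simp
    qed
    ultimately have i3: "i + 2 < length (geo w)" using i by auto
    have "simple_path T A v w (drop i (geo w))"
      using sp i i3 unfolding simple_path_def
      by (auto simp: hd_drop_conv_nth last_drop dest: in_set_dropD)
    moreover have "simple_path T A v w [v, w]"
      using v w e \<open>v \<noteq> w\<close> by (auto simp: simple_path_def edge_sym)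
    ultimately have "drop i (geo w) = [v, w]" using simple_path_ex1[OF v w] by blast
    then have "length (drop i (geo w)) = 2" by simp
    then show False using i3 by simp
  qed
  then show ne: "v \<noteq> \<phi>" using sp unfolding simple_path_def by (metis hd_in_set)
  have g: "geo v = geo w @ [v]"
    by (rule geo_eqI[OF v simple_path_snoc[OF sp v nin e]])
  have "last (geo w) = w" using sp by (simp add: simple_path_def)
  then show "par v = w" by (simp add: parent_def ne g)
qed

lemma children_iff:
  assumes "w \<in> T"
  shows "v \<in> chd w \<longleftrightarrow> v \<in> T \<and> v \<noteq> \<phi> \<and> par v = w"
proof
  assume "v \<in> chd w"
  then show "v \<in> T \<and> v \<noteq> \<phi> \<and> par v = w"
    using par_eqI[OF assms, of v] by (auto simp: children_def)
next
  assume v: "v \<in> T \<and> v \<noteq> \<phi> \<and> par v = w"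
  have "v \<noteq> par w"
  proof
    assume "v = par w"
    then show False using ht_par[of v] ht_par[of w] v assms by (cases "w = \<phi>") auto
  qed
  then show "v \<in> chd w" using geo_par(2)[of v] v by (simp add: children_def)
qed

section \<open>The descendant order\<close>

lemma sub_iff: "v \<in> T \<Longrightarrow> v \<in> sub w \<longleftrightarrow> w = v \<or> v \<noteq> \<phi> \<and> par v \<in> sub w"
  using geo_par[of v] par_in[of v] by (cases "v = \<phi>") (auto simp: subtree_def geo_root)

lemma sub_refl [simp]: "v \<in> T \<Longrightarrow> v \<in> sub v"
  using sub_iff by blast

lemma root_sub_iff: "\<phi> \<in> sub w \<longleftrightarrow> w = \<phi>"
  by (auto simp: subtree_def geo_root)

lemma sub_in: "v \<in> sub w \<Longrightarrow> v \<in> T"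
  by (simp add: subtree_def)

lemma sub_in': "v \<in> sub w \<Longrightarrow> w \<in> T"
  using simple_path_geo[of v] by (auto simp: subtree_def simple_path_def)

lemma sub_induct [consumes 1, case_names refl step]:
  assumes "v \<in> sub w" "P w"
    and "\<And>v. v \<in> T \<Longrightarrow> v \<noteq> \<phi> \<Longrightarrow> par v \<in> sub w \<Longrightarrow> P (par v) \<Longrightarrow> P v"
  shows "P v"
  using assms(1)
proof (induction "ht v" arbitrary: v)
  case 0
  then have "v = \<phi>" using sub_in ht_eq_0_iff by auto
  then show ?case using 0 assms(2) by (simp add: root_sub_iff)
next
  case (Suc n)
  have "v \<in> T" using Suc sub_in by auto
  show ?case
  proof (cases "v = w")
    case False
    then have "v \<noteq> \<phi>" "par v \<in> sub w" using Suc sub_iff[OF \<open>v \<in> T\<close>] by auto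
    then show ?thesis using Suc ht_par[OF \<open>v \<in> T\<close>] assms(3) \<open>v \<in> T\<close> by auto
  qed (simp add: assms(2))
qed

lemma sub_par: "v \<in> T \<Longrightarrow> v \<in> sub (par v)"
  using sub_iff[of v "par v"] sub_refl[OF par_in, of v] by (cases "v = \<phi>") auto

lemma sub_root: "v \<in> T \<Longrightarrow> v \<in> sub \<phi>"
  using simple_path_geo[of v] hd_in_set by (fastforce simp: subtree_def simple_path_def)

lemma sub_trans: "u \<in> sub v \<Longrightarrow> v \<in> sub w \<Longrightarrow> u \<in> sub w"
  by (induction rule: sub_induct) (use sub_iff in blast)+

lemma sub_ht: "v \<in> sub w \<Longrightarrow> ht w \<le> ht v"
  by (induction rule: sub_induct) (auto simp: ht_par)

lemma sub_eq: "v \<in> sub w \<Longrightarrow> ht v \<le> ht w \<Longrightarrow> v = w"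
  using sub_in[of v w] sub_iff[of v w] sub_ht[of "par v" w] ht_par[of v] by auto

lemma sub_par_of_ne: "v \<in> sub w \<Longrightarrow> v \<noteq> w \<Longrightarrow> v \<noteq> \<phi> \<and> par v \<in> sub w"
  using sub_in[of v w] sub_iff[of v w] by auto

lemma children_sub: "w \<in> T \<Longrightarrow> v \<in> chd w \<Longrightarrow> v \<in> sub w"
  using sub_par children_iff by auto

lemma sub_children:
  assumes "v \<in> sub w" "v \<noteq> w"
  shows "\<exists>c\<in>chd w. v \<in> sub c"
proof -
  have "v = w \<or> (\<exists>c\<in>chd w. v \<in> sub c)"
    using assms(1)
  proof (induction rule: sub_induct)
    case (step v)
    then show ?case using sub_in'[OF assms(1)] sub_par[of v] by (metis children_iff sub_trans sub_refl)
  qed simp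
  then show ?thesis using assms(2) by simp
qed

lemma ht_children: "w \<in> T \<Longrightarrow> v \<in> chd w \<Longrightarrow> ht v = Suc (ht w)"
  using ht_par children_iff by auto

lemma sub_linear:
  assumes "v \<in> sub w" "v \<in> sub w'" "ht w \<le> ht w'"
  shows "w' \<in> sub w"
  using assms
proof (induction rule: sub_induct)
  case refl
  then show ?case using sub_eq sub_ht sub_in' by (metis sub_refl order_antisym)
next
  case (step v)
  then show ?case using sub_iff[OF step(1)] by (metis sub_par sub_trans)
qed

lemma sub_unique: "v \<in> sub w \<Longrightarrow> v \<in> sub w' \<Longrightarrow> ht w = ht w' \<Longrightarrow> w = w'"
  using sub_linear sub_eq by (metis order_refl)

lemma ancestor_ex:
  assumes "v \<in> T" "n \<le> ht v"
  shows "\<exists>w. v \<in> sub w \<and> ht w = n"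
  using assms
proof (induction "ht v - n" arbitrary: v)
  case 0
  then show ?case by (metis sub_refl diff_is_0_eq le_antisym)
next
  case (Suc k)
  then have "v \<noteq> \<phi>" by auto
  then have "ht v = Suc (ht (par v))" using Suc ht_par by auto
  then obtain w where "par v \<in> sub w" "ht w = n"
    using Suc.hyps(1)[of "par v"] Suc.hyps(2) Suc.prems par_in by force
  then show ?case using Suc.prems sub_par sub_trans by blast
qed

text \<open>If \<open>w\<close> has a single child, the branching vertex below \<open>w\<close> lies below that child, as does
  \<open>v\<close>. Hence the first branching vertex below \<open>w\<close> is on the path from \<open>w\<close> to \<open>v\<close>.\<close>

lemma branching_on_path:
  fixes f :: "'a \<Rightarrow> real"
  assumes mono: "\<And>v w. v \<in> sub w \<Longrightarrow> f v \<le> f w"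
    and loss: "\<And>p c. p \<in> T \<Longrightarrow> c \<in> chd p \<Longrightarrow> card (chd p) \<ge> 2 \<Longrightarrow> f c \<le> q * f p"
    and "0 \<le> q" "b \<in> sub w" "card (chd b) \<ge> 2" "v \<in> sub w" "ht b < ht v"
  shows "f v \<le> q * f w"
  using assms(4,6)
proof (induction "ht b - ht w" arbitrary: w rule: less_induct)
  case less
  have w: "w \<in> T" using less.prems sub_in' by auto
  have "v \<noteq> w" using less.prems sub_ht assms(7) by fastforce
  then obtain c where c: "c \<in> chd w" "v \<in> sub c" using sub_children less.prems by blast
  show ?case
  proof (cases "card (chd w) \<ge> 2")
    case True
    then show ?thesis using mono[OF c(2)] loss[OF w c(1)] by linarith
  next
    case False
    then have "b \<noteq> w" using assms(5) by auto
    then obtain c' where c': "c' \<in> chd w" "b \<in> sub c'" using sub_children less.prems by blast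
    have "c' = c"
      using False c c' card_le_Suc0_iff_eq[OF finite_children[OF w]] by auto
    then have "b \<in> sub c" using c' by simp
    then have "f v \<le> q * f c"
      using less.hyps[of c] c sub_ht[of b c] ht_children[OF w c(1)] by simp
    also have "\<dots> \<le> q * f w" using mono[OF children_sub[OF w c(1)]] \<open>0 \<le> q\<close> by (rule mult_left_mono)
    finally show ?thesis .
  qed
qed

text \<open>Stacking \<open>k\<close> blocks gives \<open>q ^ k\<close>; \<open>k\<close> is later
  chosen large enough to absorb the comparison constants when decay passes from masses to
  diameters.\<close>

lemma uniformly_branching_decay:
  fixes f :: "'a \<Rightarrow> real"
  assumes br: "uniformly_branching T A \<phi>"
    and mono: "\<And>v w. v \<in> sub w \<Longrightarrow> f v \<le> f w"
    and loss: "\<And>p c. p \<in> T \<Longrightarrow> c \<in> chd p \<Longrightarrow> card (chd p) \<ge> 2 \<Longrightarrow> f c \<le> q * f p"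
    and "0 \<le> q"
  shows "\<exists>m. \<forall>k w v. v \<in> sub w \<longrightarrow> ht w + k * m \<le> ht v \<longrightarrow> f v \<le> q ^ k * f w"
proof -
  obtain N where N: "\<And>w. w \<in> T \<Longrightarrow> \<exists>b\<in>sub w. ht b \<le> ht w + N \<and> card (chd b) \<ge> 2"
    using br by (auto simp: uniformly_branching_def)
  \<comment> \<open>One level more than \<open>N\<close>: the branching vertex must lie strictly
    above \<open>v\<close>, since the loss occurs in passing to a child.\<close>
  have step: "f v \<le> q * f w" if vw: "v \<in> sub w" "ht w + Suc N \<le> ht v" for v w
  proof -
    obtain b where "b \<in> sub w" "ht b \<le> ht w + N" "card (chd b) \<ge> 2"
      using N sub_in'[OF vw(1)] by blast
    then show ?thesis using branching_on_path[where f = f and q = q, OF mono loss \<open>0 \<le> q\<close>] vw by simp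
  qed
  have "f v \<le> q ^ k * f w" if "v \<in> sub w" "ht w + k * Suc N \<le> ht v" for k w v
    using that
  proof (induction k arbitrary: v)
    case 0
    then show ?case using mono by simp
  next
    case (Suc k)
    have "ht w + k * Suc N \<le> ht v" using Suc.prems by simp
    then obtain u where u: "v \<in> sub u" "ht u = ht w + k * Suc N"
      using ancestor_ex[OF sub_in[OF Suc.prems(1)]] by blast
    have "u \<in> sub w" using sub_linear[OF Suc.prems(1) u(1)] u(2) by simp
    then have "f u \<le> q ^ k * f w" using Suc.IH u by simp
    then have "q * f u \<le> q * (q ^ k * f w)" using \<open>0 \<le> q\<close> by (rule mult_left_mono)
    moreover have "f v \<le> q * f u" using step[OF u(1)] u(2) Suc.prems by simp
    ultimately show ?case by (simp add: mult.assoc)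
  qed
  then show ?thesis by blast
qed

text \<open>By induction each initial segment is a geodesic, which supplies the distinctness
  demanded of a ray.\<close>

lemma rays_memI:
  assumes "\<omega> 0 = \<phi>" "\<And>m. \<omega> (Suc m) \<in> chd (\<omega> m)"
  shows "\<omega> \<in> rays T A \<phi>"
proof -
  have T: "\<omega> m \<in> T" for m
    using assms by (cases m) (auto simp: children_def)
  have "geo (\<omega> m) = map \<omega> [0..<Suc m]" for m
  proof (induction m)
    case 0
    then show ?case by (simp add: assms geo_root)
  next
    case (Suc m)
    then show ?case using assms(2)[of m] T geo_par(3)[of "\<omega> (Suc m)"]
      by (simp add: children_iff)
  qed
  then show ?thesis
    using simple_path_geo[OF T] by (auto simp: rays_def)
qed

end

section \<open>Weighted partitions\<close>

text \<open>\<open>g_shrink\<close> is what makes the cuts cover the space; for diameters it encodes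
  that the cells along a ray shrink to a point.\<close>

locale weighted_partition = rooted_tree_loc T A \<phi>
  for T :: "'a set" and A \<phi> +
  fixes K :: "'a \<Rightarrow> 'x set" and g :: "'a \<Rightarrow> real"
  assumes cell_children: "w \<in> T \<Longrightarrow> K w = (\<Union>v\<in>chd w. K v)"
    and minimal: "minimal_partition T A \<phi> K"
    and g_root: "g \<phi> = 1"
    and g_par: "v \<in> T \<Longrightarrow> g v \<le> g (par v)"
    and g_shrink: "w \<in> T \<Longrightarrow> x \<in> K w \<Longrightarrow> 0 < \<epsilon> \<Longrightarrow> \<exists>v\<in>sub w. x \<in> K v \<and> g v < \<epsilon>"
begin

abbreviation "\<Lambda> \<equiv> scale T A \<phi> g"
abbreviation "nb \<equiv> nbhd T A \<phi> K g"

section \<open>Cells and minimality\<close>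

lemma cell_mono: "v \<in> sub w \<Longrightarrow> K v \<subseteq> K w"
proof (induction rule: sub_induct)
  case (step v)
  have "v \<in> chd (par v)" using step by (simp add: children_iff par_in)
  then have "K v \<subseteq> K (par v)" using cell_children[OF par_in[OF step(1)]] by blast
  then show ?case using step by blast
qed simp

lemma g_mono: "v \<in> sub w \<Longrightarrow> g v \<le> g w"
  by (induction rule: sub_induct) (use g_par order_trans in auto)

lemma g_le_1: "v \<in> T \<Longrightarrow> g v \<le> 1"
  using g_mono[OF sub_root] g_root by simp

lemma cell_nonempty: "w \<in> T \<Longrightarrow> K w \<noteq> {}"
  using minimal by (auto simp: minimal_partition_def)

lemma cell_level:
  assumes "w \<in> T" "x \<in> K w" "ht w \<le> n"
  shows "\<exists>v\<in>sub w. ht v = n \<and> x \<in> K v"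
  using assms(3)
proof (induction n rule: dec_induct)
  case base
  then show ?case using assms by auto
next
  case (step n)
  then obtain v where v: "v \<in> sub w" "ht v = n" "x \<in> K v" by blast
  then obtain c where c: "c \<in> chd v" "x \<in> K c" using cell_children[OF sub_in] by blast
  then show ?case
    using v ht_children children_sub sub_trans sub_in by blast
qed

text \<open>Minimality gives a point of \<open>K u\<close> in no other cell of that level. The
  descendants of \<open>v\<close> at that level cover \<open>K v\<close>, so one of them contains
  the point and must be \<open>u\<close>.\<close>

lemma cell_subset_imp_sub:
  assumes "u \<in> T" "v \<in> T" "K u \<subseteq> K v" "ht v \<le> ht u"
  shows "u \<in> sub v"
proof -
  obtain z where z: "z \<in> K u" "\<And>v. v \<in> T \<Longrightarrow> ht v = ht u \<Longrightarrow> z \<in> K v \<Longrightarrow> v = u"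
    using minimal assms(1) by (fastforce simp: minimal_partition_def level_def)
  obtain v' where "v' \<in> sub v" "ht v' = ht u" "z \<in> K v'"
    using cell_level[OF assms(2) _ assms(4)] z(1) assms(3) by blast
  then show ?thesis using z(2) sub_in by blast
qed

section \<open>Cuts at a given scale\<close>

lemma cut_in: "w \<in> \<Lambda> s \<Longrightarrow> w \<in> T"
  by (auto simp: scale_def split: if_splits)

lemma cut_le: "w \<in> \<Lambda> s \<Longrightarrow> g w \<le> s"
  using g_root by (auto simp: scale_def split: if_splits)

lemma cut_par: "w \<in> \<Lambda> s \<Longrightarrow> s < 1 \<Longrightarrow> s < g (par w)"
  by (auto simp: scale_def)

lemma cut_root: "w \<in> \<Lambda> s \<Longrightarrow> 1 \<le> s \<Longrightarrow> w = \<phi>"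
  by (auto simp: scale_def)

text \<open>Take the highest descendant of \<open>w\<close> that contains \<open>x\<close> and has
  weight at most \<open>s\<close>. As \<open>s < g w\<close>, it is not \<open>w\<close>, so its
  parent still descends from \<open>w\<close> and contains \<open>x\<close>; being higher, the
  parent must have weight above \<open>s\<close>.\<close>

lemma cut_cover:
  assumes "w \<in> T" "x \<in> K w" "0 < s" "s < g w"
  shows "\<exists>v\<in>sub w. v \<in> \<Lambda> s \<and> x \<in> K v"
proof -
  let ?P = "\<lambda>n. \<exists>v\<in>sub w. x \<in> K v \<and> g v \<le> s \<and> ht v = n"
  have "\<exists>n. ?P n" using g_shrink[OF assms(1-3)] less_imp_le by blast
  then have "?P (LEAST n. ?P n)" by (rule LeastI_ex)
  then obtain v where v: "v \<in> sub w" "x \<in> K v" "g v \<le> s" "ht v = (LEAST n. ?P n)" by blast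
  have "v \<noteq> w" using v assms(4) by auto
  then have p: "v \<noteq> \<phi>" "par v \<in> sub w" using v sub_par_of_ne by auto
  have "v \<in> T" using v sub_in by auto
  then have "x \<in> K (par v)" using cell_mono[OF sub_par] v by blast
  moreover have "\<not> ?P (ht (par v))" using not_less_Least[of "ht (par v)" ?P] v ht_par[OF \<open>v \<in> T\<close>] p by simp
  ultimately have "s < g (par v)" using p by force
  then show ?thesis using v \<open>v \<in> T\<close> assms(4) g_le_1[OF assms(1)] by (auto simp: scale_def)
qed

lemma cut_cover_root: "x \<in> K \<phi> \<Longrightarrow> 0 < s \<Longrightarrow> \<exists>v\<in>\<Lambda> s. x \<in> K v"
  using cut_cover[of \<phi> x s] g_root by (cases "s < 1") (auto simp: scale_def)

text \<open>For \<open>t < 1\<close>, the highest ancestor of \<open>u\<close> with weight at most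
  \<open>t\<close> is in the cut, as its parent would otherwise be a higher choice.\<close>

lemma cut_ancestor:
  assumes "u \<in> \<Lambda> s" "s \<le> t"
  shows "\<exists>v\<in>\<Lambda> t. u \<in> sub v"
proof (cases "t < 1")
  case True
  let ?P = "\<lambda>n. \<exists>v. u \<in> sub v \<and> g v \<le> t \<and> ht v = n"
  have "\<exists>n. ?P n" using cut_le[OF assms(1)] assms(2) cut_in[OF assms(1)] sub_refl by fastforce
  then have "?P (LEAST n. ?P n)" by (rule LeastI_ex)
  then obtain v where v: "u \<in> sub v" "g v \<le> t" "ht v = (LEAST n. ?P n)" by blast
  have "v \<noteq> \<phi>" using v g_root True by auto
  have "v \<in> T" using v sub_in' by auto
  have "\<not> ?P (ht (par v))"
    using not_less_Least[of "ht (par v)" ?P] v ht_par[OF \<open>v \<in> T\<close>] \<open>v \<noteq> \<phi>\<close> by simp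
  moreover have "u \<in> sub (par v)" using v sub_trans sub_par \<open>v \<in> T\<close> by blast
  ultimately have "t < g (par v)" by force
  then show ?thesis using v \<open>v \<in> T\<close> True by (auto simp: scale_def)
next
  case False
  then show ?thesis using sub_root[OF cut_in[OF assms(1)]] by (auto simp: scale_def)
qed

text \<open>If \<open>v\<close> is strictly lower than \<open>u\<close>, minimality applied to the
  ancestor of \<open>v\<close> at the height of \<open>u\<close> makes \<open>u\<close> a proper
  ancestor of \<open>v\<close>. Then the parent of \<open>v\<close> has weight at most
  \<open>t\<close>, against membership of \<open>v\<close> in the cut.\<close>

lemma cut_sub:
  assumes u: "u \<in> \<Lambda> s" and v: "v \<in> \<Lambda> t" and "s \<le> t" and sub: "K u \<subseteq> K v"
  shows "u \<in> sub v"
proof (cases "ht v \<le> ht u")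
  case True
  then show ?thesis using cell_subset_imp_sub cut_in assms by blast
next
  case False
  have T: "u \<in> T" "v \<in> T" using u v cut_in by auto
  obtain v' where v': "v \<in> sub v'" "ht v' = ht u" using ancestor_ex[of v "ht u"] T False by auto
  then have "u \<in> sub v'" using cell_subset_imp_sub[of u v'] cell_mono sub T sub_in' by fastforce
  then have "u = v'" using v' sub_eq by simp
  then have "par v \<in> sub u" using sub_par_of_ne[OF v'(1)] False by auto
  then have "g (par v) \<le> t" using g_mono cut_le[OF u] \<open>s \<le> t\<close> by force
  moreover have "t < 1" using cut_root[OF v] False by force
  ultimately show ?thesis using cut_par[OF v] by simp
qed

lemma cut_antichain:
  assumes "u \<in> \<Lambda> s" "v \<in> \<Lambda> s" "v \<in> sub u"
  shows "u = v"
  using cut_sub[OF assms(1,2)] assms sub_par_of_ne[OF assms(3)] g_mono[of "par v" u]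
    cut_le[OF assms(1)] cut_par[OF assms(2)] cut_root[of _ s] by fastforce

section \<open>Chain neighbourhoods\<close>

lemma nb_0: "nb 0 x s = (\<Union>u\<in>{u\<in>\<Lambda> s. x \<in> K u}. K u)"
  by (auto simp: nbhd_def)

text \<open>With this recursion, later facts on neighbourhoods become inductions on \<open>M\<close>
  without indexed chains.\<close>

lemma nb_Suc: "nb (Suc M) x s = (\<Union>u\<in>{u\<in>\<Lambda> s. K u \<inter> nb M x s \<noteq> {}}. K u)"
proof (intro set_eqI iffI)
  fix y assume "y \<in> nb (Suc M) x s"
  then obtain w where w: "\<forall>i\<in>{1..M+2}. w i \<in> \<Lambda> s" "x \<in> K (w 1)" "y \<in> K (w (M+2))"
    "\<forall>i\<in>{1..M+1}. K (w i) \<inter> K (w (i+1)) \<noteq> {}"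
    by (auto simp: nbhd_def)
  then obtain z where z: "z \<in> K (w (M+1))" "z \<in> K (w (M+2))" by fastforce
  have "z \<in> nb M x s" using w z(1) by (auto simp: nbhd_def intro!: exI[of _ w])
  then show "y \<in> (\<Union>u\<in>{u\<in>\<Lambda> s. K u \<inter> nb M x s \<noteq> {}}. K u)"
    using w(1,3) z(2) by (intro UN_I[of "w (M+2)"]) auto
next
  fix y assume "y \<in> (\<Union>u\<in>{u\<in>\<Lambda> s. K u \<inter> nb M x s \<noteq> {}}. K u)"
  then obtain u z where u: "u \<in> \<Lambda> s" "y \<in> K u" "z \<in> K u" "z \<in> nb M x s" by blast
  then obtain w where w: "\<forall>i\<in>{1..M+1}. w i \<in> \<Lambda> s" "x \<in> K (w 1)" "z \<in> K (w (M+1))"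
    "\<forall>i\<in>{1..M}. K (w i) \<inter> K (w (i+1)) \<noteq> {}"
    by (auto simp: nbhd_def)
  let ?w = "w(M+2 := u)"
  have "?w i \<in> \<Lambda> s" if "i \<in> {1..Suc M+1}" for i
    using w(1) u that by (cases "i = M+2") auto
  moreover have "K (?w i) \<inter> K (?w (i+1)) \<noteq> {}" if "i \<in> {1..Suc M}" for i
    using w(3,4) u that by (cases "i = M+1") auto
  ultimately show "y \<in> nb (Suc M) x s"
    using w(2) u(2) unfolding nbhd_def by (intro CollectI exI[of _ ?w]) auto
qed

lemma nb_cell: "y \<in> nb M x s \<Longrightarrow> \<exists>u\<in>\<Lambda> s. y \<in> K u"
  by (cases M) (auto simp: nb_0 nb_Suc)

lemma nb_Suc_mono: "nb M x s \<subseteq> nb (Suc M) x s"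
  using nb_cell by (fastforce simp: nb_Suc)

lemma nb_mono_length: "M \<le> M' \<Longrightarrow> nb M x s \<subseteq> nb M' x s"
  by (rule lift_Suc_mono_le[of "\<lambda>M. nb M x s"]) (auto intro: nb_Suc_mono[THEN subsetD])

text \<open>Each cell of a chain may be replaced by the larger cell of its ancestor in the coarser
  cut, which preserves all intersections.\<close>

lemma nb_mono_scale:
  assumes "s \<le> t"
  shows "nb M x s \<subseteq> nb M x t"
proof (induction M)
  case 0
  show ?case
  proof
    fix y assume "y \<in> nb 0 x s"
    then obtain u where u: "u \<in> \<Lambda> s" "x \<in> K u" "y \<in> K u" by (auto simp: nb_0)
    obtain v where "v \<in> \<Lambda> t" "u \<in> sub v" using cut_ancestor[OF u(1) assms] by blast
    then show "y \<in> nb 0 x t" using cell_mono u by (fastforce simp: nb_0)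
  qed
next
  case (Suc M)
  show ?case
  proof
    fix y assume "y \<in> nb (Suc M) x s"
    then obtain u z where u: "u \<in> \<Lambda> s" "z \<in> K u" "z \<in> nb M x s" "y \<in> K u" by (auto simp: nb_Suc)
    obtain v where v: "v \<in> \<Lambda> t" "u \<in> sub v" using cut_ancestor[OF u(1) assms] by blast
    have "z \<in> K v" "z \<in> nb M x t" "y \<in> K v" using cell_mono[OF v(2)] u Suc by auto
    then show "y \<in> nb (Suc M) x t" using v by (auto simp: nb_Suc)
  qed
qed

lemma cell_subset_nb: "w \<in> \<Lambda> s \<Longrightarrow> x \<in> K w \<Longrightarrow> K w \<subseteq> nb M x s"
  using nb_mono_length[of 0 M x s] by (auto simp: nb_0)

text \<open>Thickness does not depend on the length of the chains: around a point that is deep inside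
  a cell \<open>K v\<close> which is itself deep inside \<open>K w\<close>, the first \<open>M\<close> links of a chain stay
  in \<open>K v\<close> and the last one stays in \<open>K w\<close>.\<close>

lemma thick_chain:
  assumes "thick T A \<phi> K g" "0 < b"
  shows "\<exists>\<beta>>0. \<beta> \<le> b \<and> (\<forall>s\<in>{0<..1}. \<forall>w\<in>\<Lambda> s. \<exists>x\<in>K w. nb M x (\<beta> * s) \<subseteq> K w)"
proof -
  obtain M0 a where a: "M0 \<ge> 1" "a > 0" "\<forall>s\<in>{0<..1}. \<forall>w\<in>\<Lambda> s. \<exists>x\<in>K w. nb M0 x (a * s) \<subseteq> K w"
    using assms(1) by (auto simp: thick_def)
  \<comment> \<open>At most \<open>a\<close> so that thickness applies, at most \<open>b\<close> for
    the required bound, at most 1 so that \<open>e * s\<close> is again a scale in the unit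
    interval.\<close>
  define e where "e = Min {a, b, 1}"
  have e: "0 < e" "e \<le> a" "e \<le> b" "e \<le> 1" using a assms(2) by (auto simp: e_def)
  have thick1: "\<exists>x\<in>K w. nb 1 x (e * s) \<subseteq> K w" if sw: "s \<in> {0<..1}" "w \<in> \<Lambda> s" for s w
  proof -
    obtain x where x: "x \<in> K w" "nb M0 x (a * s) \<subseteq> K w" using a(3) sw by blast
    have "e * s \<le> a * s" using e sw by simp
    then have "nb 1 x (e * s) \<subseteq> K w"
      using nb_mono_length[OF a(1), of x "e * s"] nb_mono_scale[of "e * s" "a * s" M0 x] x(2) by blast
    then show ?thesis using x(1) by blast
  qed
  show ?thesis
  proof (induction M)
    case 0
    have "nb 0 x s \<subseteq> nb 1 x s" for x s using nb_Suc_mono[of 0] by simp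
    then have "\<forall>s\<in>{0<..1}. \<forall>w\<in>\<Lambda> s. \<exists>x\<in>K w. nb 0 x (e * s) \<subseteq> K w"
      using thick1 by blast
    then show ?case using e by blast
  next
    case (Suc M)
    then obtain \<beta> where \<beta>: "0 < \<beta>" "\<beta> \<le> b"
      "\<And>s w. s \<in> {0<..1} \<Longrightarrow> w \<in> \<Lambda> s \<Longrightarrow> \<exists>x\<in>K w. nb M x (\<beta> * s) \<subseteq> K w"
      by blast
    \<comment> \<open>The cap at 1 lets a cut at scale \<open>\<gamma> * e * s\<close> be coarsened
      to one at \<open>e * s\<close>.\<close>
    define \<gamma> where "\<gamma> = min \<beta> 1"
    have \<gamma>: "0 < \<gamma>" "\<gamma> \<le> \<beta>" "\<gamma> \<le> 1" using \<beta> by (auto simp: \<gamma>_def)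
    have "\<exists>y\<in>K w. nb (Suc M) y (\<gamma> * e * s) \<subseteq> K w" if s: "s \<in> {0<..1}" and w: "w \<in> \<Lambda> s" for s w
    proof -
      obtain x where x: "x \<in> K w" "nb 1 x (e * s) \<subseteq> K w" using thick1 s w by blast
      have es: "e * s \<in> {0<..1}" using e s by (auto intro: mult_le_one)
      obtain v where v: "v \<in> \<Lambda> (e * s)" "x \<in> K v"
        using cut_cover_root[of x "e * s"] es x(1) cell_mono[OF sub_root[OF cut_in[OF w]]] by auto
      have vw: "K v \<subseteq> K w" using cell_subset_nb[OF v] x(2) by blast
      obtain y where y: "y \<in> K v" "nb M y (\<beta> * (e * s)) \<subseteq> K v" using \<beta>(3) es v(1) by blast
      have "\<gamma> * e * s \<le> \<beta> * (e * s)"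
        using \<gamma>(2) es mult_right_mono[of \<gamma> \<beta> "e * s"] by (simp add: mult.assoc)
      then have nbv: "nb M y (\<gamma> * e * s) \<subseteq> K v" using nb_mono_scale y(2) by blast
      have "nb (Suc M) y (\<gamma> * e * s) \<subseteq> K w"
      proof
        fix q assume "q \<in> nb (Suc M) y (\<gamma> * e * s)"
        then obtain u z where u: "u \<in> \<Lambda> (\<gamma> * e * s)" "z \<in> K u" "z \<in> K v" "q \<in> K u"
          using nbv by (auto simp: nb_Suc)
        \<comment> \<open>The last cell \<open>u\<close> meets \<open>K v\<close>; so does its
          ancestor at the scale of \<open>v\<close>, which therefore lies within one link of
          \<open>x\<close>, hence in \<open>K w\<close>.\<close>
        have "\<gamma> * e * s \<le> e * s" using \<gamma> es by (simp add: mult.assoc mult_left_le_one_le)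
        then obtain u' where u': "u' \<in> \<Lambda> (e * s)" "u \<in> sub u'" using cut_ancestor u(1) by blast
        have "z \<in> K u'" "q \<in> K u'" using cell_mono[OF u'(2)] u by auto
        moreover have "z \<in> nb 0 x (e * s)" using u(3) v by (auto simp: nb_0)
        ultimately have "q \<in> nb 1 x (e * s)" using u'(1) nb_Suc[of 0] by auto
        then show "q \<in> K w" using x(2) by blast
      qed
      then show ?thesis using y(1) vw by blast
    qed
    moreover have "\<gamma> * e \<le> b" using \<gamma> e mult_mono[of \<gamma> 1 e b] by simp
    ultimately show ?case using \<gamma> e by (intro exI[of _ "\<gamma> * e"]) auto
  qed
qed

text \<open>By minimality, a cell of scale \<open>\<beta> * s\<close> inside \<open>K w\<close> is indexed by a descendant of \<open>w\<close>. So
  the cell around a thick centre is surrounded by descendants of \<open>w\<close> only.\<close>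

lemma thick_core:
  assumes "thick T A \<phi> K g" "0 < b"
  shows "\<exists>\<beta>>0. \<beta> \<le> b \<and> \<beta> \<le> 1 \<and> (\<forall>s\<in>{0<..1}. \<forall>w\<in>\<Lambda> s. \<exists>u\<in>\<Lambda> (\<beta> * s). K u \<subseteq> K w \<and>
           (\<forall>u'\<in>\<Lambda> (\<beta> * s). K u' \<inter> K u \<noteq> {} \<longrightarrow> u' \<in> sub w))"
proof -
  obtain \<beta> where \<beta>: "0 < \<beta>" "\<beta> \<le> min b 1"
    "\<And>s w. s \<in> {0<..1} \<Longrightarrow> w \<in> \<Lambda> s \<Longrightarrow> \<exists>x\<in>K w. nb 1 x (\<beta> * s) \<subseteq> K w"
    using thick_chain[OF assms(1), of "min b 1" 1] assms(2) by auto
  have "\<exists>u\<in>\<Lambda> (\<beta> * s). K u \<subseteq> K w \<and> (\<forall>u'\<in>\<Lambda> (\<beta> * s). K u' \<inter> K u \<noteq> {} \<longrightarrow> u' \<in> sub w)"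
    if s: "s \<in> {0<..1}" and w: "w \<in> \<Lambda> s" for s w
  proof -
    obtain x where x: "x \<in> K w" "nb 1 x (\<beta> * s) \<subseteq> K w" using \<beta>(3) s w by blast
    obtain u where u: "u \<in> \<Lambda> (\<beta> * s)" "x \<in> K u"
      using cut_cover_root[of x "\<beta> * s"] \<beta>(1) s x(1) cell_mono[OF sub_root[OF cut_in[OF w]]] by auto
    have "u' \<in> sub w" if u': "u' \<in> \<Lambda> (\<beta> * s)" "K u' \<inter> K u \<noteq> {}" for u'
    proof -
      have "K u' \<subseteq> nb 1 x (\<beta> * s)"
        using u' cell_subset_nb[OF u, of 0] nb_Suc[of 0 x "\<beta> * s"] by fastforce
      then have "K u' \<subseteq> K w" using x(2) by blast
      then show ?thesis using cut_sub[OF u'(1) w] \<beta> s by (simp add: mult_left_le_one_le)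
    qed
    then show ?thesis using u cell_subset_nb[OF u] x(2) by blast
  qed
  then show ?thesis using \<beta> by auto
qed

text \<open>Each link multiplies the count by at most \<open>N\<close>. The exponent starts at 1
  because all cut cells containing \<open>x\<close> meet any one of them.\<close>

lemma nb_finite_cover:
  assumes fin: "\<And>w. w \<in> \<Lambda> s \<Longrightarrow> finite {v\<in>\<Lambda> s. K v \<inter> K w \<noteq> {}} \<and> card {v\<in>\<Lambda> s. K v \<inter> K w \<noteq> {}} \<le> N"
  shows "\<exists>W\<subseteq>\<Lambda> s. finite W \<and> card W \<le> N ^ Suc M \<and> nb M x s \<subseteq> (\<Union>u\<in>W. K u)"
proof (induction M)
  case 0
  show ?case
  proof (cases "\<exists>w\<in>\<Lambda> s. x \<in> K w")
    case True
    then obtain w where w: "w \<in> \<Lambda> s" "x \<in> K w" by blast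
    show ?thesis
      using fin[OF w(1)] w by (intro exI[of _ "{v\<in>\<Lambda> s. K v \<inter> K w \<noteq> {}}"]) (auto simp: nb_0)
  next
    case False
    then show ?thesis by (intro exI[of _ "{}"]) (auto simp: nb_0)
  qed
next
  case (Suc M)
  then obtain W where W: "W \<subseteq> \<Lambda> s" "finite W" "card W \<le> N ^ Suc M" "nb M x s \<subseteq> (\<Union>u\<in>W. K u)"
    by blast
  let ?W = "\<Union>w\<in>W. {v\<in>\<Lambda> s. K v \<inter> K w \<noteq> {}}"
  have "card ?W \<le> (\<Sum>w\<in>W. card {v\<in>\<Lambda> s. K v \<inter> K w \<noteq> {}})"
    using W(2) by (rule card_UN_le)
  also have "\<dots> \<le> card W * N"
    using sum_bounded_above[of W "\<lambda>w. card {v\<in>\<Lambda> s. K v \<inter> K w \<noteq> {}}" N] fin W(1) by auto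
  also have "\<dots> \<le> N ^ Suc (Suc M)"
    using W(3) by (simp add: mult.commute)
  finally have "card ?W \<le> N ^ Suc (Suc M)" .
  moreover have "nb (Suc M) x s \<subseteq> (\<Union>u\<in>?W. K u)"
    using W(4) by (fastforce simp: nb_Suc)
  ultimately show ?case using W fin by (intro exI[of _ ?W]) auto
qed

end

section \<open>Measures on weighted partitions\<close>

locale measured_partition = weighted_partition T A \<phi> K g
  for T :: "'a set" and A \<phi> and K :: "'a \<Rightarrow> 'x set" and g +
  fixes d :: "'x metric" and \<mu> :: "'x measure" and \<alpha> :: real and M :: nat
  assumes root_cell: "K \<phi> = mspace d"
    and dist_le: "w \<in> T \<Longrightarrow> x \<in> K w \<Longrightarrow> y \<in> K w \<Longrightarrow> mdist d x y \<le> g w"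
    and diam_1: "mdiam d (mspace d) = 1"
    and adapted: "adapted_to T A \<phi> K M d g"
    and prob: "prob_space \<mu>"
    and sets_cell [measurable]: "w \<in> T \<Longrightarrow> K w \<in> sets \<mu>"
    and sets_ball [measurable]: "mball_of d x r \<in> sets \<mu>"
    and alpha_pos: "0 < \<alpha>"
    and super: "super_exponential T A \<phi> g"
    and thick: "thick T A \<phi> K g"
begin

sublocale prob_space \<mu> by (rule prob)

abbreviation "gm \<equiv> \<lambda>w. measure \<mu> (K w)"

lemma g_pos: "w \<in> T \<Longrightarrow> 0 < g w"
  using super by (simp add: super_exponential_def)

lemma cell_space: "w \<in> T \<Longrightarrow> K w \<subseteq> mspace d"
  using cell_mono[OF sub_root] root_cell by simp

lemma gm_mono: "v \<in> sub w \<Longrightarrow> gm v \<le> gm w"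
  using cell_mono sub_in' by (intro finite_measure_mono) auto

text \<open>For \<open>s < 1\<close> the parent of a cut vertex has weight above \<open>s\<close>,
  and super-exponentiality limits the drop to one factor \<open>c\<close>. At \<open>s = 1\<close>
  the cut is the root alone, whose weight is 1.\<close>

lemma cut_ge:
  assumes "\<forall>w\<in>T. \<forall>v\<in>chd w. c * g w \<le> g v" "0 < c" "c < 1" "u \<in> \<Lambda> s" "0 < s" "s \<le> 1"
  shows "c * s \<le> g u"
proof (cases "s < 1")
  case True
  have u: "u \<in> T" "s < g (par u)" using cut_in cut_par assms True by auto
  have "u \<noteq> \<phi>" using True cut_le[OF assms(4)] g_root by auto
  then have "c * g (par u) \<le> g u" using assms(1) u by (simp add: children_iff par_in)
  moreover have "c * s \<le> c * g (par u)" using u assms by simp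
  ultimately show ?thesis by simp
next
  case False
  then show ?thesis using cut_root[OF assms(4)] g_root assms by auto
qed

text \<open>Regularity speaks of radii up to the diameter 1, whereas radii such as
  \<open>2 * g w\<close> and \<open>3 * s\<close> occur below. For larger radii total mass 1 gives
  the bound once the constant is at least 1.\<close>

lemma ahlfors_imp_upper:
  assumes "Ahlfors_regular \<alpha> d \<mu>"
  shows "\<exists>C>0. \<forall>x\<in>mspace d. \<forall>r>0. measure \<mu> (mball_of d x r) \<le> C * r powr \<alpha>"
proof -
  obtain C where C: "C > 0" "\<forall>x\<in>mspace d. \<forall>r\<in>{0..1}. measure \<mu> (mball_of d x r) \<le> C * r powr \<alpha>"
    using assms by (auto simp: Ahlfors_regular_def diam_1)
  have "measure \<mu> (mball_of d x r) \<le> max C 1 * r powr \<alpha>" if "x \<in> mspace d" "r > 0" for x r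
  proof (cases "r \<le> 1")
    case True
    then have "measure \<mu> (mball_of d x r) \<le> C * r powr \<alpha>" using C that by auto
    also have "\<dots> \<le> max C 1 * r powr \<alpha>" by (intro mult_right_mono) auto
    finally show ?thesis .
  next
    case False
    then have "1 * 1 \<le> max C 1 * r powr \<alpha>"
      using alpha_pos by (intro mult_mono) (auto intro: ge_one_powr_ge_zero)
    then show ?thesis using prob_le_1[of "mball_of d x r"] by linarith
  qed
  then show ?thesis by (intro exI[of _ "max C 1"]) auto
qed

section \<open>From cell masses to balls\<close>

lemma bilip_imp_ahlfors:
  assumes bl: "bi_Lipschitz_equivalent T (\<lambda>w. g w powr \<alpha>) gm" and uf: "uniformly_finite T A \<phi> K g"
  shows "Ahlfors_regular \<alpha> d \<mu>"
proof -
  obtain c1 c2 where c1: "c1 > 0" "\<And>w. w \<in> T \<Longrightarrow> c1 * g w powr \<alpha> \<le> gm w"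
    and c2: "c2 > 0" "\<And>w. w \<in> T \<Longrightarrow> gm w \<le> c2 * g w powr \<alpha>"
    using bl by (auto simp: bi_Lipschitz_equivalent_def)
  obtain N where N: "\<And>s w. 0 < s \<Longrightarrow> s \<le> 1 \<Longrightarrow> w \<in> \<Lambda> s \<Longrightarrow>
      finite {v\<in>\<Lambda> s. K v \<inter> K w \<noteq> {}} \<and> card {v\<in>\<Lambda> s. K v \<inter> K w \<noteq> {}} \<le> N"
    using uf unfolding uniformly_finite_def by (meson greaterThanAtMost_iff)
  obtain a1 a2 where a: "a1 > 0" "a2 > 0"
    and ball: "\<And>x r. x \<in> mspace d \<Longrightarrow> r > 0 \<Longrightarrow> nb M x (a1 * r) \<subseteq> mball_of d x r"
      "\<And>x r. x \<in> mspace d \<Longrightarrow> r > 0 \<Longrightarrow> mball_of d x r \<subseteq> nb M x (a2 * r)"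
    using adapted by (auto simp: adapted_to_def)
  obtain c where c: "0 < c" "c < 1" "\<forall>w\<in>T. \<forall>v\<in>chd w. c * g w \<le> g v"
    using super by (auto simp: super_exponential_def)
  \<comment> \<open>At most \<open>a1\<close>, so that the cell around \<open>x\<close> falls inside
    the ball, and at most 1, so that \<open>b * r\<close> stays in the range of
    \<open>cut_ge\<close>.\<close>
  define b where "b = min a1 1"
  have b: "0 < b" "b \<le> a1" "b \<le> 1" using a by (auto simp: b_def)
  have lower: "c1 * (c * b) powr \<alpha> * r powr \<alpha> \<le> measure \<mu> (mball_of d x r)"
    if x: "x \<in> mspace d" and r: "0 < r" "r \<le> 1" for x r
  proof -
    have s: "0 < b * r" "b * r \<le> 1" using b r by (auto intro: mult_le_one)
    obtain w where w: "w \<in> \<Lambda> (b * r)" "x \<in> K w" using cut_cover_root[of x] x s root_cell by auto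
    have wT: "w \<in> T" using w cut_in by auto
    have "c * (b * r) \<le> g w" using cut_ge[OF c(3,1,2) w(1) s] .
    then have "(c * (b * r)) powr \<alpha> \<le> g w powr \<alpha>"
      using c s alpha_pos by (intro powr_mono2) auto
    then have "c1 * (c * b) powr \<alpha> * r powr \<alpha> \<le> c1 * g w powr \<alpha>"
      using c1(1) b c r by (simp add: powr_mult mult.assoc)
    also have "\<dots> \<le> gm w" using c1 wT by simp
    also have "\<dots> \<le> measure \<mu> (mball_of d x r)"
    proof (rule finite_measure_mono)
      have "b * r \<le> a1 * r" using b r by simp
      then show "K w \<subseteq> mball_of d x r"
        using cell_subset_nb[OF w, of M] nb_mono_scale ball(1)[OF x r(1)] by blast
    qed simp
    finally show ?thesis .
  qed
  \<comment> \<open>The 1 in the maximum serves radii with \<open>a2 * r > 1\<close>, where only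
    total mass 1 is used.\<close>
  define C where "C = max 1 (real (N ^ Suc M) * c2)"
  have upper: "measure \<mu> (mball_of d x r) \<le> C * a2 powr \<alpha> * r powr \<alpha>"
    if x: "x \<in> mspace d" and r: "0 < r" for x r
  proof -
    have "measure \<mu> (mball_of d x r) \<le> C * (a2 * r) powr \<alpha>"
    proof (cases "a2 * r \<le> 1")
      case True
      have s: "0 < a2 * r" using a r by simp
      obtain W where W: "W \<subseteq> \<Lambda> (a2 * r)" "finite W" "card W \<le> N ^ Suc M" "nb M x (a2 * r) \<subseteq> (\<Union>u\<in>W. K u)"
        using nb_finite_cover[OF N[OF s True], of M x] by auto
      have WT: "W \<subseteq> T" using W(1) cut_in by auto
      have "(\<Union>u\<in>W. K u) \<in> sets \<mu>" using W(2) WT by (intro sets.finite_UN) auto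
      then have "measure \<mu> (mball_of d x r) \<le> measure \<mu> (\<Union>u\<in>W. K u)"
        using ball(2)[OF x r] W(4) by (intro finite_measure_mono) auto
      also have "\<dots> \<le> (\<Sum>u\<in>W. gm u)"
        using W(2) WT by (intro measure_UNION_le) auto
      also have "\<dots> \<le> (\<Sum>u\<in>W. c2 * (a2 * r) powr \<alpha>)"
      proof (rule sum_mono)
        fix u assume "u \<in> W"
        then have u: "u \<in> T" "g u \<le> a2 * r" using W WT cut_le by auto
        have "g u powr \<alpha> \<le> (a2 * r) powr \<alpha>"
          using u g_pos[of u] alpha_pos by (intro powr_mono2) auto
        then show "gm u \<le> c2 * (a2 * r) powr \<alpha>"
          using c2 u by (meson mult_left_mono order_trans less_imp_le)
      qed
      also have "\<dots> = real (card W) * c2 * (a2 * r) powr \<alpha>" by simp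
      also have "\<dots> \<le> real (N ^ Suc M) * c2 * (a2 * r) powr \<alpha>"
        using W(3) c2(1) by (intro mult_right_mono) (auto simp flip: of_nat_power of_nat_mult)
      also have "\<dots> \<le> C * (a2 * r) powr \<alpha>"
        unfolding C_def by (intro mult_right_mono) auto
      finally show ?thesis .
    next
      case False
      then have "1 * 1 \<le> C * (a2 * r) powr \<alpha>"
        using alpha_pos by (intro mult_mono) (auto simp: C_def intro: ge_one_powr_ge_zero)
      then show ?thesis using prob_le_1[of "mball_of d x r"] by linarith
    qed
    then show ?thesis using a r by (simp add: powr_mult mult.assoc)
  qed
  \<comment> \<open>Regularity includes \<open>r = 0\<close>, where the ball is empty and
    \<open>0 powr \<alpha>\<close> is 0.\<close>
  have "mball_of d x 0 = {}" for x by (metis equals0I in_mball_of mdist_nonneg not_less)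
  then have "c1 * (c * b) powr \<alpha> * r powr \<alpha> \<le> measure \<mu> (mball_of d x r) \<and>
      measure \<mu> (mball_of d x r) \<le> C * a2 powr \<alpha> * r powr \<alpha>"
    if "x \<in> mspace d" "0 \<le> r" "r \<le> 1" for x r
    using lower upper that by (cases "r = 0") auto
  moreover have "0 < c1 * (c * b) powr \<alpha>" "0 < C * a2 powr \<alpha>"
    using c1 c b a by (auto simp: C_def)
  ultimately show ?thesis
    unfolding Ahlfors_regular_def diam_1
    by (intro exI[of _ "c1 * (c * b) powr \<alpha>"] exI[of _ "C * a2 powr \<alpha>"]) auto
qed

section \<open>From balls to cell masses and finiteness\<close>

lemma ahlfors_imp_bilip:
  assumes ar: "Ahlfors_regular \<alpha> d \<mu>"
  shows "bi_Lipschitz_equivalent T (\<lambda>w. g w powr \<alpha>) gm"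
proof -
  obtain C where C: "C > 0"
    "\<And>x r. x \<in> mspace d \<Longrightarrow> r > 0 \<Longrightarrow> measure \<mu> (mball_of d x r) \<le> C * r powr \<alpha>"
    using ahlfors_imp_upper[OF ar] by blast
  obtain C1 where C1: "C1 > 0"
    "\<And>x r. x \<in> mspace d \<Longrightarrow> r \<ge> 0 \<Longrightarrow> r \<le> 1 \<Longrightarrow> C1 * r powr \<alpha> \<le> measure \<mu> (mball_of d x r)"
    using ar by (auto simp: Ahlfors_regular_def diam_1)
  obtain a where a: "a > 0"
    and ball: "\<And>x r. x \<in> mspace d \<Longrightarrow> r > 0 \<Longrightarrow> mball_of d x r \<subseteq> nb M x (a * r)"
    using adapted by (auto simp: adapted_to_def)
  obtain \<beta> where \<beta>: "0 < \<beta>" "\<beta> \<le> a"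
    "\<And>s w. s \<in> {0<..1} \<Longrightarrow> w \<in> \<Lambda> s \<Longrightarrow> \<exists>x\<in>K w. nb M x (\<beta> * s) \<subseteq> K w"
    using thick_chain[OF thick a, of M] by blast
  have lower: "C1 * (\<beta> / (2 * a)) powr \<alpha> * g w powr \<alpha> \<le> gm w" if w: "w \<in> T" for w
  proof -
    \<comment> \<open>\<open>w\<close> itself may lie in no cut; at half its weight some cut vertex
      lies below it.\<close>
    define s where "s = g w / 2"
    have s: "0 < s" "s < g w" "s \<le> 1" using g_pos[OF w] g_le_1[OF w] by (auto simp: s_def)
    obtain z where "z \<in> K w" using cell_nonempty[OF w] by auto
    then obtain v where v: "v \<in> sub w" "v \<in> \<Lambda> s" using cut_cover[OF w _ s(1,2)] by blast
    have "s \<in> {0<..1}" using s by simp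
    from \<beta>(3)[OF this v(2)] obtain x where x: "x \<in> K v" "nb M x (\<beta> * s) \<subseteq> K v" by blast
    have xd: "x \<in> mspace d" using x(1) cell_space cut_in[OF v(2)] by auto
    \<comment> \<open>Chosen so that \<open>a * r = \<beta> * s\<close>, the scale of the thick
      centre; \<open>\<beta> \<le> a\<close> keeps \<open>r\<close> in the range of
      regularity.\<close>
    define r where "r = \<beta> * s / a"
    have r: "0 < r" "r \<le> 1" "a * r = \<beta> * s"
      using \<beta> s a mult_mono[of \<beta> a s 1] by (auto simp: r_def)
    have "r powr \<alpha> = (\<beta> / (2 * a) * g w) powr \<alpha>" by (simp add: r_def s_def)
    also have "\<dots> = (\<beta> / (2 * a)) powr \<alpha> * g w powr \<alpha>"
      by (rule powr_mult)
    finally have "C1 * (\<beta> / (2 * a)) powr \<alpha> * g w powr \<alpha> = C1 * r powr \<alpha>" by simp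
    also have "\<dots> \<le> measure \<mu> (mball_of d x r)" using C1 xd r by auto
    also have "\<dots> \<le> gm w"
      using ball[OF xd r(1)] r(3) x(2) cell_mono[OF v(1)] w by (intro finite_measure_mono) auto
    finally show ?thesis .
  qed
  have upper: "gm w \<le> C * 2 powr \<alpha> * g w powr \<alpha>" if w: "w \<in> T" for w
  proof -
    obtain x where x: "x \<in> K w" using cell_nonempty[OF w] by auto
    have xd: "x \<in> mspace d" using x cell_space w by auto
    \<comment> \<open>Balls are open, so the radius has to exceed the bound on distances within
      \<open>K w\<close>.\<close>
    have "gm w \<le> measure \<mu> (mball_of d x (2 * g w))"
    proof (rule finite_measure_mono)
      show "K w \<subseteq> mball_of d x (2 * g w)"
        using xd cell_space[OF w] dist_le[OF w x] g_pos[OF w] by force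
    qed simp
    also have "\<dots> \<le> C * (2 * g w) powr \<alpha>" using C xd g_pos[OF w] by simp
    also have "\<dots> = C * 2 powr \<alpha> * g w powr \<alpha>" using g_pos[OF w] by (simp add: powr_mult)
    finally show ?thesis .
  qed
  have "0 < C1 * (\<beta> / (2 * a)) powr \<alpha>" "0 < C * 2 powr \<alpha>" using C1 C \<beta> a by auto
  then show ?thesis unfolding bi_Lipschitz_equivalent_def using lower upper by blast
qed

lemma ahlfors_imp_uniformly_finite:
  assumes ar: "Ahlfors_regular \<alpha> d \<mu>"
  shows "uniformly_finite T A \<phi> K g"
proof -
  obtain C where C: "C > 0"
    "\<And>x r. x \<in> mspace d \<Longrightarrow> r > 0 \<Longrightarrow> measure \<mu> (mball_of d x r) \<le> C * r powr \<alpha>"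
    using ahlfors_imp_upper[OF ar] by blast
  obtain c1 where c1: "c1 > 0" "\<And>w. w \<in> T \<Longrightarrow> c1 * g w powr \<alpha> \<le> gm w"
    using ahlfors_imp_bilip[OF ar] by (auto simp: bi_Lipschitz_equivalent_def)
  obtain c where c: "0 < c" "c < 1" "\<forall>w\<in>T. \<forall>v\<in>chd w. c * g w \<le> g v"
    using super by (auto simp: super_exponential_def)
  obtain \<beta> where \<beta>: "0 < \<beta>" "\<beta> \<le> 1"
    "\<And>s w. s \<in> {0<..1} \<Longrightarrow> w \<in> \<Lambda> s \<Longrightarrow> \<exists>u\<in>\<Lambda> (\<beta> * s). K u \<subseteq> K w \<and>
           (\<forall>u'\<in>\<Lambda> (\<beta> * s). K u' \<inter> K u \<noteq> {} \<longrightarrow> u' \<in> sub w)"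
    using thick_core[OF thick, of 1] by auto
  \<comment> \<open>The mass of a core is at least \<open>e * s powr \<alpha>\<close>, since by
    \<open>cut_ge\<close> its weight is at least \<open>c * \<beta> * s\<close>.\<close>
  define e where "e = c1 * (c * \<beta>) powr \<alpha>"
  have e: "e > 0" using c1(1) c(1) \<beta>(1) by (simp add: e_def)
  \<comment> \<open>The upper bound for the mass of a ball of radius \<open>3 * s\<close> divided by
    the lower bound for the mass of one core.\<close>
  define B where "B = C * 3 powr \<alpha> / e"
  \<comment> \<open>Bounding finite subfamilies yields the finiteness of the whole family together
    with its cardinality.\<close>
  have bound: "card F \<le> nat \<lfloor>B\<rfloor>"
    if s: "0 < s" "s \<le> 1" and w: "w \<in> \<Lambda> s" and F: "F \<subseteq> {v\<in>\<Lambda> s. K v \<inter> K w \<noteq> {}}" "finite F" for s w F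
  proof -
    obtain x where x: "x \<in> K w" using cell_nonempty[OF cut_in[OF w]] by auto
    have xd: "x \<in> mspace d" using x cell_space cut_in[OF w] by auto
    have "\<exists>u. \<forall>v\<in>F. u v \<in> \<Lambda> (\<beta> * s) \<and> K (u v) \<subseteq> K v \<and>
           (\<forall>u'\<in>\<Lambda> (\<beta> * s). K u' \<inter> K (u v) \<noteq> {} \<longrightarrow> u' \<in> sub v)"
    proof (rule bchoice, intro ballI)
      fix v assume "v \<in> F"
      then have "v \<in> \<Lambda> s" "s \<in> {0<..1}" using F(1) s by auto
      from \<beta>(3)[OF this(2,1)] show "\<exists>u. u \<in> \<Lambda> (\<beta> * s) \<and> K u \<subseteq> K v \<and>
           (\<forall>u'\<in>\<Lambda> (\<beta> * s). K u' \<inter> K u \<noteq> {} \<longrightarrow> u' \<in> sub v)" by blast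
    qed
    then obtain u where u: "\<And>v. v \<in> F \<Longrightarrow> u v \<in> \<Lambda> (\<beta> * s)" "\<And>v. v \<in> F \<Longrightarrow> K (u v) \<subseteq> K v"
      "\<And>v u'. v \<in> F \<Longrightarrow> u' \<in> \<Lambda> (\<beta> * s) \<Longrightarrow> K u' \<inter> K (u v) \<noteq> {} \<Longrightarrow> u' \<in> sub v"
      by blast
    have uT: "u v \<in> T" if "v \<in> F" for v using u(1)[OF that] cut_in by simp
    have bs: "0 < \<beta> * s" "\<beta> * s \<le> 1" using \<beta>(1) \<open>\<beta> \<le> 1\<close> s by (auto intro: mult_le_one)
    have "disjoint_family_on (\<lambda>v. K (u v)) F"
      unfolding disjoint_family_on_def
    proof (intro ballI impI, rule ccontr)
      fix v v' assume v: "v \<in> F" "v' \<in> F" "v \<noteq> v'" "K (u v) \<inter> K (u v') \<noteq> {}"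
      \<comment> \<open>If two cores meet, \<open>u v'\<close> descends from both \<open>v\<close>
        and \<open>v'\<close>, which are then comparable; distinct members of a cut are not.\<close>
      have "u v' \<in> sub v" using u(3)[OF v(1) u(1)[OF v(2)]] v(4) by blast
      moreover have "u v' \<in> sub v'" using u(3)[OF v(2) u(1)[OF v(2)]] v(4) by blast
      ultimately have "v' \<in> sub v \<or> v \<in> sub v'" using sub_linear by (metis nle_le)
      then show False using cut_antichain[of v s v'] cut_antichain[of v' s v] v F(1) by auto
    qed
    then have "(\<Sum>v\<in>F. gm (u v)) = measure \<mu> (\<Union>v\<in>F. K (u v))"
      using F(2) uT by (intro finite_measure_finite_Union[symmetric]) auto
    \<comment> \<open>Two touching cells of diameter at most \<open>s\<close> give distance at most
      \<open>2 * s\<close>; the ball is open.\<close>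
    moreover have "(\<Union>v\<in>F. K (u v)) \<subseteq> mball_of d x (3 * s)"
    proof (intro UN_least subsetI)
      fix v y assume v: "v \<in> F" and y: "y \<in> K (u v)"
      have vs: "v \<in> \<Lambda> s" using F v by auto
      obtain z where z: "z \<in> K v" "z \<in> K w" using F(1) v by auto
      have yv: "y \<in> K v" using u(2)[OF v] y by auto
      have yd: "y \<in> mspace d" "z \<in> mspace d" using yv z cell_space cut_in[OF vs] by auto
      have "mdist d x y \<le> mdist d x z + mdist d z y" using mdist_triangle xd yd by metis
      also have "\<dots> \<le> s + s"
        using dist_le[OF cut_in[OF w] x z(2)] dist_le[OF cut_in[OF vs] z(1) yv] cut_le[OF w] cut_le[OF vs]
        by linarith
      finally show "y \<in> mball_of d x (3 * s)" using xd yd s by simp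
    qed
    then have "measure \<mu> (\<Union>v\<in>F. K (u v)) \<le> measure \<mu> (mball_of d x (3 * s))"
      by (rule finite_measure_mono) simp
    moreover have "measure \<mu> (mball_of d x (3 * s)) \<le> C * (3 * s) powr \<alpha>" using C xd s by simp
    ultimately have up: "(\<Sum>v\<in>F. gm (u v)) \<le> C * 3 powr \<alpha> * s powr \<alpha>" using s by (simp add: powr_mult)
    have "(\<Sum>v\<in>F. e * s powr \<alpha>) \<le> (\<Sum>v\<in>F. gm (u v))"
    proof (rule sum_mono)
      fix v assume v: "v \<in> F"
      have "(c * (\<beta> * s)) powr \<alpha> \<le> g (u v) powr \<alpha>"
        using cut_ge[OF c(3,1,2) u(1)[OF v] bs] c bs alpha_pos by (intro powr_mono2) auto
      then have "e * s powr \<alpha> \<le> c1 * g (u v) powr \<alpha>"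
        using c1(1) by (simp add: e_def powr_mult mult.assoc)
      then show "e * s powr \<alpha> \<le> gm (u v)" using c1(2)[OF uT[OF v]] by linarith
    qed
    then have "real (card F) * e * s powr \<alpha> \<le> C * 3 powr \<alpha> * s powr \<alpha>" using up by simp
    then have "real (card F) * e \<le> C * 3 powr \<alpha>" using s by simp
    then have "real (card F) \<le> B" using e by (simp add: B_def field_simps)
    then show ?thesis by (simp add: le_nat_floor)
  qed
  show ?thesis
    unfolding uniformly_finite_def
  proof (intro exI[of _ "nat \<lfloor>B\<rfloor>"] ballI)
    fix s w assume "s \<in> {0<..1::real}" "w \<in> \<Lambda> s"
    then show "finite {v\<in>\<Lambda> s. K v \<inter> K w \<noteq> {}} \<and> card {v\<in>\<Lambda> s. K v \<inter> K w \<noteq> {}} \<le> nat \<lfloor>B\<rfloor>"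
      using bound by (intro finite_if_finite_subsets_card_bdd) auto
  qed
qed

section \<open>Exponential bounds\<close>

lemma bilip_imp_super_exponential:
  assumes bl: "bi_Lipschitz_equivalent T (\<lambda>w. g w powr \<alpha>) gm"
  shows "super_exponential T A \<phi> gm"
proof -
  obtain c1 c2 where c1: "c1 > 0" "\<And>w. w \<in> T \<Longrightarrow> c1 * g w powr \<alpha> \<le> gm w"
    and c2: "c2 > 0" "\<And>w. w \<in> T \<Longrightarrow> gm w \<le> c2 * g w powr \<alpha>"
    using bl by (auto simp: bi_Lipschitz_equivalent_def)
  obtain c where c: "0 < c" "c < 1" "\<forall>w\<in>T. \<forall>v\<in>chd w. c * g w \<le> g v"
    using super by (auto simp: super_exponential_def)
  have pos: "0 < gm w" if "w \<in> T" for w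
    using c1(1) c1(2)[OF that] g_pos[OF that] by (metis less_le_trans mult_pos_pos powr_gt_zero less_irrefl)
  \<comment> \<open>The drop of \<open>g\<close> passes through both comparison constants; 1/2 keeps
    the factor below 1.\<close>
  define e where "e = min (c1 * c powr \<alpha> / c2) (1/2)"
  have e: "0 < e" "e < 1" "e \<le> c1 * c powr \<alpha> / c2" using c1 c2 c by (auto simp: e_def)
  have "e * gm w \<le> gm v" if w: "w \<in> T" and v: "v \<in> chd w" for w v
  proof -
    have vT: "v \<in> T" using v w children_iff by auto
    have "e * gm w \<le> (c1 * c powr \<alpha> / c2) * (c2 * g w powr \<alpha>)"
      using e c2(1) c2(2)[OF w] by (intro mult_mono) auto
    also have "\<dots> = c1 * (c * g w) powr \<alpha>" using c2 c g_pos[OF w] by (simp add: powr_mult)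
    also have "\<dots> \<le> c1 * g v powr \<alpha>"
      using c c1 w v g_pos[OF w] alpha_pos by (intro mult_left_mono powr_mono2) auto
    also have "\<dots> \<le> gm v" using c1 vT by simp
    finally show ?thesis .
  qed
  then show ?thesis unfolding super_exponential_def using pos e by (intro conjI bexI[of _ e]) auto
qed

text \<open>Another child \<open>c'\<close> of \<open>p\<close> contains a core cell whose neighbours at its own scale all
  descend from \<open>c'\<close>, so the core is disjoint from \<open>K c\<close>.\<close>

lemma branching_loss:
  assumes bl: "bi_Lipschitz_equivalent T (\<lambda>w. g w powr \<alpha>) gm"
  shows "\<exists>q\<in>{0<..<1}. \<forall>p\<in>T. \<forall>c\<in>chd p. card (chd p) \<ge> 2 \<longrightarrow> gm c \<le> q * gm p"
proof -
  obtain c1 c2 where c1: "c1 > 0" "\<And>w. w \<in> T \<Longrightarrow> c1 * g w powr \<alpha> \<le> gm w"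
    and c2: "c2 > 0" "\<And>w. w \<in> T \<Longrightarrow> gm w \<le> c2 * g w powr \<alpha>"
    using bl by (auto simp: bi_Lipschitz_equivalent_def)
  obtain k where k: "0 < k" "k < 1" "\<forall>w\<in>T. \<forall>v\<in>chd w. k * g w \<le> g v"
    using super by (auto simp: super_exponential_def)
  \<comment> \<open>The bound \<open>\<beta> \<le> k\<close> puts the core scale below the weight of
    every sibling, so that cells of that scale below the sibling cover it.\<close>
  obtain \<beta> where \<beta>: "0 < \<beta>" "\<beta> \<le> k" "\<beta> \<le> 1"
    "\<And>s w. s \<in> {0<..1} \<Longrightarrow> w \<in> \<Lambda> s \<Longrightarrow> \<exists>u\<in>\<Lambda> (\<beta> * s). K u \<subseteq> K w \<and>
           (\<forall>u'\<in>\<Lambda> (\<beta> * s). K u' \<inter> K u \<noteq> {} \<longrightarrow> u' \<in> sub w)"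
    using thick_core[OF thick k(1)] by auto
  \<comment> \<open>From \<open>p\<close> to the core: a factor \<open>k\<close> for the child, 1/2
    for the choice of \<open>s\<close>, \<open>\<beta>\<close> for the core scale and
    \<open>k\<close> for the drop within the cut. The constants \<open>c1\<close> and
    \<open>c2\<close> turn weights into masses.\<close>
  define \<delta> where "\<delta> = c1 * (k * \<beta> * k / 2) powr \<alpha> / c2"
  have \<delta>: "\<delta> > 0" using c1(1) c2(1) k(1) \<beta>(1) by (simp add: \<delta>_def)
  have loss: "gm c \<le> (1 - \<delta>) * gm p" if p: "p \<in> T" and c: "c \<in> chd p" and br: "card (chd p) \<ge> 2" for p c
  proof -
    have "\<not> chd p \<subseteq> {c}" using br card_mono[of "{c}" "chd p"] by auto
    then obtain c' where c': "c' \<in> chd p" "c' \<noteq> c" by blast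
    have T: "c \<in> T" "c' \<in> T" using c c' p children_iff by auto
    define s where "s = g c' / 2"
    have s: "0 < s" "s < g c'" "s \<le> 1" using g_pos[OF T(2)] g_le_1[OF T(2)] by (auto simp: s_def)
    obtain z where "z \<in> K c'" using cell_nonempty[OF T(2)] by auto
    then obtain y where y: "y \<in> sub c'" "y \<in> \<Lambda> s" using cut_cover[OF T(2) _ s(1,2)] by blast
    obtain u where u: "u \<in> \<Lambda> (\<beta> * s)" "K u \<subseteq> K y"
      "\<And>u'. u' \<in> \<Lambda> (\<beta> * s) \<Longrightarrow> K u' \<inter> K u \<noteq> {} \<Longrightarrow> u' \<in> sub y"
      using \<beta>(4)[OF _ y(2)] s by auto
    have uT: "u \<in> T" using u cut_in by auto
    have bs: "0 < \<beta> * s" "\<beta> * s \<le> 1" using \<beta>(1) \<open>\<beta> \<le> 1\<close> s by (auto intro: mult_le_one)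
    have gc': "k * g p \<le> g c'" using k p c' by auto
    have "\<beta> * s < \<beta> * g c'" using \<beta>(1) s by simp
    also have "\<dots> \<le> k * g p"
      using \<beta>(1,2) k(1) g_mono[OF children_sub[OF p c'(1)]] g_pos[OF T(2)] by (intro mult_mono) auto
    also have "\<dots> \<le> g c" using k p c by auto
    finally have bsc: "\<beta> * s < g c" .
    \<comment> \<open>A point common to \<open>K c\<close> and the core lies in a core-scale cell
      below \<open>c\<close>, and that cell would descend from the sibling \<open>c'\<close> as
      well.\<close>
    have disj: "K c \<inter> K u = {}"
    proof (rule ccontr)
      assume "K c \<inter> K u \<noteq> {}"
      then obtain z where z: "z \<in> K c" "z \<in> K u" by auto
      obtain u' where u': "u' \<in> sub c" "u' \<in> \<Lambda> (\<beta> * s)" "z \<in> K u'"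
        using cut_cover[OF T(1) z(1) bs(1) bsc] by auto
      have "u' \<in> sub c'" using u(3)[OF u'(2)] u'(3) z(2) y(1) sub_trans by blast
      then have "c' = c" using sub_unique[OF u'(1)] ht_children[OF p] c c' by metis
      then show False using c' by simp
    qed
    have "K u \<subseteq> K p" using u(2) cell_mono[OF y(1)] cell_mono[OF children_sub[OF p c'(1)]] by blast
    then have "measure \<mu> (K c \<union> K u) \<le> gm p"
      using cell_mono[OF children_sub[OF p c]] p by (intro finite_measure_mono) auto
    then have sum: "gm c + gm u \<le> gm p"
      using finite_measure_Union[OF sets_cell[OF T(1)] sets_cell[OF uT] disj] by simp
    have "k * \<beta> * k / 2 * g p \<le> k * (\<beta> * s)"
      using gc' k(1) \<beta>(1) by (simp add: s_def mult.assoc)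
    also have "\<dots> \<le> g u" using cut_ge[OF k(3,1,2) u(1) bs] .
    finally have "(k * \<beta> * k / 2 * g p) powr \<alpha> \<le> g u powr \<alpha>"
      using k(1) \<beta>(1) g_pos[OF p] alpha_pos by (intro powr_mono2) auto
    then have "c1 * ((k * \<beta> * k / 2) powr \<alpha> * g p powr \<alpha>) \<le> c1 * g u powr \<alpha>"
      using c1(1) by (subst powr_mult[symmetric]) auto
    also have "\<dots> \<le> gm u" using c1 uT by simp
    finally have "\<delta> * (c2 * g p powr \<alpha>) \<le> gm u" using c2(1) by (simp add: \<delta>_def)
    moreover have "\<delta> * gm p \<le> \<delta> * (c2 * g p powr \<alpha>)" using \<delta> c2 p by (intro mult_left_mono) auto
    ultimately show ?thesis using sum by (simp add: algebra_simps)
  qed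
  define q where "q = max (1 - \<delta>) (1/2)"
  have "gm c \<le> q * gm p" if "p \<in> T" "c \<in> chd p" "card (chd p) \<ge> 2" for p c
  proof -
    have "gm c \<le> (1 - \<delta>) * gm p" using loss that by auto
    also have "\<dots> \<le> q * gm p" unfolding q_def by (intro mult_right_mono) auto
    finally show ?thesis .
  qed
  moreover have "q \<in> {0<..<1}" using \<delta> by (auto simp: q_def)
  ultimately show ?thesis by blast
qed

lemma bilip_imp_sub_exponential:
  assumes bl: "bi_Lipschitz_equivalent T (\<lambda>w. g w powr \<alpha>) gm" and br: "uniformly_branching T A \<phi>"
  shows "sub_exponential T A \<phi> gm" "sub_exponential T A \<phi> g"
proof -
  obtain c1 c2 where c1: "c1 > 0" "\<And>w. w \<in> T \<Longrightarrow> c1 * g w powr \<alpha> \<le> gm w"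
    and c2: "c2 > 0" "\<And>w. w \<in> T \<Longrightarrow> gm w \<le> c2 * g w powr \<alpha>"
    using bl by (auto simp: bi_Lipschitz_equivalent_def)
  obtain q where q: "0 < q" "q < 1"
    "\<And>p c. p \<in> T \<Longrightarrow> c \<in> chd p \<Longrightarrow> card (chd p) \<ge> 2 \<Longrightarrow> gm c \<le> q * gm p"
    using branching_loss[OF bl] by auto
  obtain m where m: "\<And>k w v. v \<in> sub w \<Longrightarrow> ht w + k * m \<le> ht v \<Longrightarrow> gm v \<le> q ^ k * gm w"
    using uniformly_branching_decay[where f = gm and q = q, OF br gm_mono q(3)] q(1) by auto
  have pos: "\<forall>w\<in>T. 0 < gm w"
    using bilip_imp_super_exponential[OF bl] by (simp add: super_exponential_def)
  show "sub_exponential T A \<phi> gm"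
    unfolding sub_exponential_def
    using m[of _ _ 1] pos q by (intro conjI exI[of _ m] bexI[of _ q]) auto
  \<comment> \<open>\<open>q ^ k\<close> has to beat the ratio \<open>c2 / c1\<close> and still
    leave a factor 1/2, which becomes \<open>e\<close> after taking the root of order
    \<alpha>.\<close>
  obtain k where k: "q ^ k < c1 / (2 * c2)"
    using real_arch_pow_inv[of "c1 / (2 * c2)" q] c1 c2 q by auto
  define e where "e = (1/2) powr (1/\<alpha>)"
  have e: "0 < e" "e < 1" "e powr \<alpha> = 1/2"
    using alpha_pos by (auto simp: e_def powr_powr powr01_less_one)
  have "g v \<le> e * g w" if v: "v \<in> sub w" "ht v \<ge> ht w + k * m" for v w
  proof -
    have T: "v \<in> T" "w \<in> T" using v sub_in sub_in' by auto
    have "c1 * g v powr \<alpha> \<le> q ^ k * gm w" using c1(2)[OF T(1)] m[OF v] by simp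
    also have "\<dots> \<le> c1 / (2 * c2) * (c2 * g w powr \<alpha>)"
      using k q c1 c2 T by (intro mult_mono) auto
    also have "\<dots> = c1 * (e * g w) powr \<alpha>" using c2 e g_pos[OF T(2)] by (simp add: powr_mult)
    finally have "g v powr \<alpha> \<le> (e * g w) powr \<alpha>" using c1 by simp
    then show ?thesis
      using alpha_pos g_pos T e powr_less_mono2[of \<alpha> "e * g w" "g v"] by force
  qed
  then show "sub_exponential T A \<phi> g"
    unfolding sub_exponential_def
    using e g_pos by (intro conjI exI[of _ "k * m"] bexI[of _ e]) auto
qed

end

section \<open>The diameter weight\<close>

text \<open>Compactness bounds the distances; only then is the real supremum in \<open>mdiam\<close>
  an upper bound.\<close>

lemma mdist_le_mdiam:
  assumes "compactin (mtopology_of d) S" "x \<in> S" "y \<in> S"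
  shows "mdist d x y \<le> mdiam d S"
proof -
  interpret Metric_space "mspace d" "mdist d" by simp
  have "mbounded S" using compactin_imp_mbounded assms(1) by (simp add: mtopology_of_def)
  then obtain B where "\<forall>x\<in>S. \<forall>y\<in>S. mdist d x y \<le> B" by (auto simp: mbounded_alt)
  then have "bdd_above ((\<lambda>(x, y). mdist d x y) ` (S \<times> S))" by (intro bdd_aboveI[of _ B]) auto
  then show ?thesis
    unfolding mdiam_def using cSUP_upper[of "(x, y)" "S \<times> S" "\<lambda>(x, y). mdist d x y"] assms by simp
qed

lemma mdiam_le:
  assumes "S \<noteq> {}" "\<And>x y. x \<in> S \<Longrightarrow> y \<in> S \<Longrightarrow> mdist d x y \<le> b"
  shows "mdiam d S \<le> b"
  unfolding mdiam_def using assms by (intro cSUP_least) auto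

text \<open>\<open>partition_param\<close> speaks of intersections along full rays from the root, so
  smallness below \<open>w\<close> near \<open>x\<close> needs a ray through \<open>w\<close> whose
  cells all contain \<open>x\<close>.\<close>

lemma (in rooted_tree_loc) ray_through:
  assumes children: "\<And>w. w \<in> T \<Longrightarrow> K w = (\<Union>v\<in>chd w. K v)" and w: "w \<in> T" "x \<in> K w"
  shows "\<exists>\<omega>\<in>rays T A \<phi>. (\<forall>m. x \<in> K (\<omega> m)) \<and> (\<forall>m\<ge>ht w. \<omega> m \<in> sub w) \<and>
           (\<forall>m. K (\<omega> (Suc m)) \<subseteq> K (\<omega> m))"
proof -
  have down: "K v \<subseteq> K u" if "v \<in> sub u" for u v
    using that
  proof (induction rule: sub_induct)
    case (step v)
    then have "v \<in> chd (par v)" by (simp add: children_iff par_in)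
    then show ?case using children[OF par_in[OF step(1)]] step(4) by blast
  qed simp
  \<comment> \<open>Comparability with \<open>w\<close> steers the ray: above \<open>w\<close> it
    follows the path to \<open>w\<close>, from there on any child containing \<open>x\<close> will
    do.\<close>
  define P where "P m v \<longleftrightarrow> v \<in> T \<and> ht v = m \<and> x \<in> K v \<and> (w \<in> sub v \<or> v \<in> sub w)" for m v
  have "\<exists>\<omega>. \<forall>m. P m (\<omega> m) \<and> \<omega> (Suc m) \<in> chd (\<omega> m)"
  proof (rule dependent_nat_choice)
    have "P 0 \<phi>" using w down[OF sub_root] sub_root by (auto simp: P_def)
    then show "\<exists>v. P 0 v" ..
  next
    fix v m assume v: "P m v"
    show "\<exists>c. P (Suc m) c \<and> c \<in> chd v"
    proof (cases "v \<in> sub w")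
      case True
      obtain c where c: "c \<in> chd v" "x \<in> K c" using v children[of v] by (auto simp: P_def)
      have "c \<in> sub w" using True sub_trans[OF children_sub[OF _ c(1)]] v by (simp add: P_def)
      then show ?thesis
        using c v ht_children[OF _ c(1)] sub_in[of c] by (intro exI[of _ c]) (auto simp: P_def)
    next
      case False
      then have "w \<in> sub v" "w \<noteq> v" using v w by (auto simp: P_def)
      then obtain c where c: "c \<in> chd v" "w \<in> sub c" using sub_children by blast
      then show ?thesis
        using v w down[OF c(2)] ht_children[OF _ c(1)] sub_in'[OF c(2)]
        by (intro exI[of _ c]) (auto simp: P_def)
    qed
  qed
  then obtain \<omega> where \<omega>: "\<And>m. P m (\<omega> m)" "\<And>m. \<omega> (Suc m) \<in> chd (\<omega> m)" by blast
  have "\<omega> \<in> rays T A \<phi>"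
  proof (rule rays_memI)
    show "\<omega> 0 = \<phi>" using \<omega>(1)[of 0] ht_eq_0_iff[of "\<omega> 0"] by (simp add: P_def)
  qed (rule \<omega>(2))
  moreover have "\<omega> m \<in> sub w" if "ht w \<le> m" for m
    using \<omega>(1)[of m] that sub_eq[of w "\<omega> m"] by (auto simp: P_def)
  moreover have "K (\<omega> (Suc m)) \<subseteq> K (\<omega> m)" for m
    using \<omega>[of m] down[OF children_sub] by (simp add: P_def)
  moreover have "x \<in> K (\<omega> m)" for m
    using \<omega>(1)[of m] by (simp add: P_def)
  ultimately show ?thesis by blast
qed

lemma diameter_weighted_partition:
  assumes tree: "rooted_tree T A \<phi>" and X: "X = mtopology_of d" "compact_space X"
    and K: "partition_param X T A \<phi> K" and min: "minimal_partition T A \<phi> K"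
    and diam: "mdiam d (mspace d) = 1"
  shows "weighted_partition T A \<phi> K (\<lambda>w. mdiam d (K w))"
proof -
  interpret rooted_tree_loc T A \<phi> by unfold_locales (rule tree)
  interpret Metric_space "mspace d" "mdist d" by simp
  have Xm: "X = mtopology" by (simp add: X mtopology_of_def)
  have children: "K w = (\<Union>v\<in>chd w. K v)" if "w \<in> T" for w
    using K that unfolding partition_param_def by blast
  have cpt: "compactin X (K w)" "K w \<noteq> {}" if "w \<in> T" for w
    using K that unfolding partition_param_def by auto
  have diam_mono: "mdiam d (K v) \<le> mdiam d (K w)" if "v \<in> T" "w \<in> T" "K v \<subseteq> K w" for v w
    using that cpt[of w] by (intro mdiam_le cpt(2)[OF that(1)]) (auto intro!: mdist_le_mdiam simp: X)
  show ?thesis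
  proof unfold_locales
    show "mdiam d (K \<phi>) = 1"
      using K diam by (simp add: partition_param_def X)
  next
    fix v assume v: "v \<in> T"
    show "mdiam d (K v) \<le> mdiam d (K (par v))"
    proof (cases "v = \<phi>")
      case False
      then have "v \<in> chd (par v)" using v by (simp add: children_iff par_in)
      then show ?thesis using children[OF par_in[OF v]] v by (intro diam_mono par_in) auto
    qed simp
  next
    fix w x and \<epsilon> :: real assume w: "w \<in> T" "x \<in> K w" and "0 < \<epsilon>"
    obtain \<omega> where \<omega>: "\<omega> \<in> rays T A \<phi>" "\<And>m. x \<in> K (\<omega> m)" "\<And>m. ht w \<le> m \<Longrightarrow> \<omega> m \<in> sub w"
      "\<And>m. K (\<omega> (Suc m)) \<subseteq> K (\<omega> m)"
      using ray_through[of K, OF children w] by blast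
    have \<omega>T: "\<omega> m \<in> T" for m
      using \<omega>(1) by (auto simp: rays_def simple_path_def)
    have dec: "decseq (\<lambda>m. K (\<omega> m))" using \<omega>(4) by (intro decseq_SucI) auto
    have "\<forall>\<omega>\<in>rays T A \<phi>. \<exists>z. (\<Inter>m. K (\<omega> m)) = {z}"
      using K unfolding partition_param_def by simp
    from bspec[OF this \<omega>(1)] obtain z where z: "(\<Inter>m. K (\<omega> m)) = {z}" ..
    have "x \<in> (\<Inter>m. K (\<omega> m))" using \<omega>(2) by simp
    then have "z = x" using z by simp
    have xd: "x \<in> mspace d" using compactin_subset_topspace[OF cpt(1)[OF w(1)]] w(2) by (auto simp: X)
    \<comment> \<open>The parts of the cells outside a ball around \<open>x\<close> are nested
      closed sets with empty intersection, so by compactness one of them is empty. Radius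
      \<open>\<epsilon> / 3\<close> makes the final diameter bound strict.\<close>
    define C where "C m = K (\<omega> m) - mball x (\<epsilon> / 3)" for m
    have "\<exists>m. C m = {}"
    proof (rule ccontr)
      assume ne: "\<nexists>m. C m = {}"
      have "(\<Inter>m. C m) \<noteq> {}"
      proof (rule compact_space_imp_nest[OF X(2)])
        fix m
        have "closedin X (K (\<omega> m))"
          using compactin_imp_closedin[of X] cpt(1)[OF \<omega>T] Hausdorff_space_mtopology Xm by blast
        then show "closedin X (C m)" unfolding C_def by (intro closedin_diff) (auto simp: Xm)
      next
        show "decseq C" using dec by (auto simp: C_def decseq_def)
      qed (use ne in blast)
      then obtain y where "\<And>m. y \<in> C m" by blast
      then have "y \<in> (\<Inter>m. K (\<omega> m))" "y \<notin> mball x (\<epsilon> / 3)" unfolding C_def by blast+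
      then show False using z \<open>z = x\<close> xd \<open>0 < \<epsilon>\<close> by simp
    qed
    then obtain m where "C m = {}" ..
    \<comment> \<open>At least \<open>ht w\<close>, so that the small cell lies below
      \<open>w\<close>.\<close>
    define n where "n = max m (ht w)"
    have "K (\<omega> n) \<subseteq> K (\<omega> m)" using dec by (simp add: n_def decseq_def)
    then have near: "y \<in> mspace d" "mdist d x y < \<epsilon> / 3" if "y \<in> K (\<omega> n)" for y
      using \<open>C m = {}\<close> that by (auto simp: C_def)
    have "mdiam d (K (\<omega> n)) \<le> \<epsilon> / 3 + \<epsilon> / 3"
    proof (rule mdiam_le[OF cpt(2)[OF \<omega>T]])
      fix y y' assume y: "y \<in> K (\<omega> n)" "y' \<in> K (\<omega> n)"
      have "mdist d y y' \<le> mdist d y x + mdist d x y'"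
        using triangle near(1)[OF y(1)] xd near(1)[OF y(2)] .
      then show "mdist d y y' \<le> \<epsilon> / 3 + \<epsilon> / 3"
        using near(2)[OF y(1)] near(2)[OF y(2)] by (simp add: commute)
    qed
    then show "\<exists>v\<in>sub w. x \<in> K v \<and> mdiam d (K v) < \<epsilon>"
      using \<omega>(2)[of n] \<omega>(3)[of n] \<open>0 < \<epsilon>\<close> by (intro bexI[of _ "\<omega> n"]) (auto simp: n_def)
  qed (use children tree min in auto)
qed

text \<open>Super-exponentiality is concluded outright. Sub-exponentiality is tied to
  \<open>uniformly_branching\<close>, since a chain of single children repeats one cell and keeps
  both weights constant along it.\<close>

theorem theorem8p21:
  fixes T :: "'a set" and A :: "'a \<Rightarrow> 'a \<Rightarrow> nat" and \<phi> :: 'a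
    and X :: "'x topology" and K :: "'a \<Rightarrow> 'x set"
    and d :: "'x metric" and \<mu> :: "'x measure" and \<alpha> :: real
  defines "g\<^sub>d \<equiv> \<lambda>w. mdiam d (K w)"
    and "g\<^sub>\<mu> \<equiv> \<lambda>w. measure \<mu> (K w)"
  assumes "rooted_tree T A \<phi>"
    and "compact_space X" and "metrizable_space X"
    and "\<forall>x\<in>topspace X. \<not> openin X {x}"
    and "partition_param X T A \<phi> K"
    and "d \<in> adapted_metrics X T A \<phi> K"
    and "\<mu> \<in> partition_measures X T K"
    and "\<alpha> > 0"
    and "minimal_partition T A \<phi> K"
    and "super_exponential T A \<phi> g\<^sub>d"
    and "thick T A \<phi> K g\<^sub>d"
  shows "(bi_Lipschitz_equivalent T (\<lambda>w. g\<^sub>d w powr \<alpha>) g\<^sub>\<mu> \<and> uniformly_finite T A \<phi> K g\<^sub>d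
            \<longleftrightarrow> Ahlfors_regular \<alpha> d \<mu>) \<and>
         (bi_Lipschitz_equivalent T (\<lambda>w. g\<^sub>d w powr \<alpha>) g\<^sub>\<mu> \<and> uniformly_finite T A \<phi> K g\<^sub>d
            \<or> Ahlfors_regular \<alpha> d \<mu>
          \<longrightarrow> super_exponential T A \<phi> g\<^sub>\<mu> \<and> super_exponential T A \<phi> g\<^sub>d \<and>
              (uniformly_branching T A \<phi> \<longrightarrow>
                 exponential T A \<phi> g\<^sub>\<mu> \<and> exponential T A \<phi> g\<^sub>d))"
proof -
  have X: "X = mtopology_of d" and diam: "mdiam d (mspace d) = 1"
    using assms by (auto simp: adapted_metrics_def metrics_on_def)
  obtain M where M: "adapted_to T A \<phi> K M d g\<^sub>d"
    using assms by (auto simp: adapted_metrics_def)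
  have \<mu>: "prob_space \<mu>" "space \<mu> = topspace X" "sets \<mu> = sigma_sets (topspace X) {U. openin X U}"
    using assms by (auto simp: partition_measures_def radon_prob_def)
  have open_sets: "U \<in> sets \<mu>" if "openin X U" for U
    using that by (simp add: \<mu>(3) sigma_sets.Basic)
  have cpt: "compactin X (K w)" if "w \<in> T" for w
    using assms that unfolding partition_param_def by auto
  interpret weighted_partition T A \<phi> K g\<^sub>d
    unfolding g\<^sub>d_def using assms X diam by (intro diameter_weighted_partition) auto
  interpret measured_partition T A \<phi> K g\<^sub>d d \<mu> \<alpha> M
  proof (intro measured_partition.intro measured_partition_axioms.intro)
    show "K \<phi> = mspace d" using assms by (simp add: partition_param_def X)
    show "mdist d x y \<le> g\<^sub>d w" if "w \<in> T" "x \<in> K w" "y \<in> K w" for w x y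
      using cpt[OF that(1)] that by (auto simp: g\<^sub>d_def X intro: mdist_le_mdiam)
    show "K w \<in> sets \<mu>" if "w \<in> T" for w
    proof -
      have "closedin X (K w)"
        using compactin_imp_closedin cpt[OF that] assms metrizable_imp_Hausdorff_space by blast
      then have "topspace X - (topspace X - K w) = K w" "openin X (topspace X - K w)"
        using closedin_subset by (auto simp: closedin_def)
      then show ?thesis using open_sets sets.compl_sets \<mu>(2) by metis
    qed
    show "mball_of d x r \<in> sets \<mu>" for x r
    proof -
      interpret Metric_space "mspace d" "mdist d" by simp
      show ?thesis by (intro open_sets) (simp add: X mtopology_of_def mball_of_def)
    qed
    show "weighted_partition T A \<phi> K g\<^sub>d" by unfold_locales
  qed (fact diam M \<mu>(1) \<open>\<alpha> > 0\<close> \<open>super_exponential T A \<phi> g\<^sub>d\<close> \<open>thick T A \<phi> K g\<^sub>d\<close>)+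
  have "bi_Lipschitz_equivalent T (\<lambda>w. g\<^sub>d w powr \<alpha>) g\<^sub>\<mu> \<and> uniformly_finite T A \<phi> K g\<^sub>d
          \<longleftrightarrow> Ahlfors_regular \<alpha> d \<mu>"
    using bilip_imp_ahlfors ahlfors_imp_bilip ahlfors_imp_uniformly_finite
    unfolding g\<^sub>\<mu>_def by blast
  moreover have "super_exponential T A \<phi> g\<^sub>\<mu> \<and>
      (uniformly_branching T A \<phi> \<longrightarrow> exponential T A \<phi> g\<^sub>\<mu> \<and> exponential T A \<phi> g\<^sub>d)"
    if "bi_Lipschitz_equivalent T (\<lambda>w. g\<^sub>d w powr \<alpha>) g\<^sub>\<mu>"
    using bilip_imp_super_exponential bilip_imp_sub_exponential that super
    unfolding g\<^sub>\<mu>_def exponential_def by blast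
  ultimately show ?thesis using super by blast
qed

end
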